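(* Let $\mu,F\in C_c^\infty(\mathbb C)$ (complex-valued) with $|\mu|\le k<1$ on $\mathbb C$. Let $g\in L^1_{\mathrm{loc}}(\mathbb C)$ have weak derivative $Dg\in L^2(\mathbb C)$. If $g$ satisfies $$\partial_{\bar z} g-\mu\,\partial_z g = F$$ in the sense of distributions on $\mathbb C$, then $g$ is continuous (that is, $g$ agrees almost everywhere with a continuous function).
   Context: $\partial_z = \frac12(\partial_x - i\partial_y)$ and $\partial_{\bar z}=\frac12(\partial_x+i\partial_y)$, where $z=x+iy$. *)

theory Defs
  imports "HOL-Analysis.Analysis"
begin

text \<open>The plane is the type \<^typ>\<open>complex\<close>, regarded as a real vector space with basis
  \<^term>\<open>1\<close>, \<^term>\<open>\<i>\<close>. Thus the directional derivatives along \<^term>\<open>1\<close> and \<^term>\<open>\<i>\<close>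
  are the partial derivatives with respect to x and y, and smoothness below is real smoothness.\<close>

definition partial :: "complex \<Rightarrow> (complex \<Rightarrow> complex) \<Rightarrow> complex \<Rightarrow> complex" where
  "partial e f z = frechet_derivative f (at z) e"

primrec C_k :: "nat \<Rightarrow> (complex \<Rightarrow> complex) \<Rightarrow> bool" where
  "C_k 0 f \<longleftrightarrow> continuous_on UNIV f"
| "C_k (Suc n) f \<longleftrightarrow>
     (\<forall>z. f differentiable (at z)) \<and> C_k n (partial 1 f) \<and> C_k n (partial \<i> f)"

definition Cc_infinity :: "(complex \<Rightarrow> complex) set" where
  "Cc_infinity = {f. (\<forall>n. C_k n f) \<and> compact (closure (support_on UNIV f))}"

definition L1_loc :: "(complex \<Rightarrow> complex) set" where
  "L1_loc = {f. \<forall>K. compact K \<longrightarrow> f absolutely_integrable_on K}"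

definition L2 :: "(complex \<Rightarrow> complex) set" where
  "L2 = {f. f \<in> borel_measurable lebesgue \<and> integrable lebesgue (\<lambda>z. (cmod (f z))\<^sup>2)}"

text \<open>A distribution is given by its values on test functions; its values elsewhere are
  irrelevant, so equality of distributions is \<open>distr_eq\<close> and not \<open>=\<close>. The pairing is
  bilinear (no complex conjugation).\<close>

type_synonym distr = "(complex \<Rightarrow> complex) \<Rightarrow> complex"

definition distr_eq :: "distr \<Rightarrow> distr \<Rightarrow> bool" where
  "distr_eq S T \<longleftrightarrow> (\<forall>\<phi>\<in>Cc_infinity. S \<phi> = T \<phi>)"

definition distr_of :: "(complex \<Rightarrow> complex) \<Rightarrow> distr" where
  "distr_of f \<phi> = (\<integral>z. f z * \<phi> z \<partial>lebesgue)"

definition distr_partial :: "complex \<Rightarrow> distr \<Rightarrow> distr" where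
  "distr_partial e T \<phi> = - T (partial e \<phi>)"

definition distr_dz :: "distr \<Rightarrow> distr" where
  "distr_dz T \<phi> = (distr_partial 1 T \<phi> - \<i> * distr_partial \<i> T \<phi>) / 2"

definition distr_dzbar :: "distr \<Rightarrow> distr" where
  "distr_dzbar T \<phi> = (distr_partial 1 T \<phi> + \<i> * distr_partial \<i> T \<phi>) / 2"

definition distr_mult :: "(complex \<Rightarrow> complex) \<Rightarrow> distr \<Rightarrow> distr" where
  "distr_mult m T \<phi> = T (\<lambda>z. m z * \<phi> z)"

definition has_weak_partial ::
  "(complex \<Rightarrow> complex) \<Rightarrow> complex \<Rightarrow> (complex \<Rightarrow> complex) \<Rightarrow> bool" where
  "has_weak_partial g e u \<longleftrightarrow>
     u \<in> L1_loc \<and> distr_eq (distr_partial e (distr_of g)) (distr_of u)"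

end

theory Submission
  imports Defs
begin

section \<open>The idea of the proof\<close>

text \<open>Test everything against the translates of a smooth product kernel \<open>\<rho>(t) = r(Re t) r(Im t)\<close>, where \<open>r\<close> is
a bump on a short interval \<open>[0, h]\<close>. The regularised functions \<open>\<rho> * g\<close> (written \<^term>\<open>corr\<close> below) satisfy a Hoelder estimate that does not depend on
the kernel, and letting the kernel shrink to a point gives continuity of \<open>g\<close>. Only the Hilbert space
\<open>L\<^sup>2\<close> is used; there is no singular integral.

The first ingredient is an energy identity. For a function regularised by a test kernel, the
\<open>L\<^sup>2\<close> norms of its derivatives with respect to \<open>z\<close> and to its conjugate agree, because the
difference of the squares is a Jacobian determinant and integrates to zero. Here it is applied to the
\<open>x\<close>-derivative of \<open>\<rho> * g\<close>. Since \<open>\<rho>\<^sub>x * g\<^sub>y = \<rho>\<^sub>y * g\<^sub>x\<close>, both of its derivatives are correlations of the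
single square integrable function \<open>g\<^sub>x\<close>, with the kernels \<open>\<rho>\<^sub>x\<close> and \<open>\<rho>\<^sub>y\<close>, and the identity reduces to a
symmetry of these two kernels, whatever the function is
(\<open>tensor_kernel_symmetric\<close>, \<open>energy_identity\<close>).

Testing the equation with the translates of \<open>\<rho>\<^sub>x\<close> shows that the two regularised derivatives
\<open>A\<close> and \<open>B\<close> (of the conjugate derivative and of the \<open>z\<close>-derivative of \<open>g\<close>) satisfy \<open>A = \<mu> B + E\<close>.
The error \<open>E\<close> collects the commutator of \<open>\<mu>\<close> with the regularisation and the contribution of \<open>F\<close>. Both are
bounded in \<open>L\<^sup>2\<close> independently of \<open>h\<close>: \<open>\<mu>\<close> and \<open>F\<close> are Lipschitz, and the factor \<open>\<bar>t - z\<bar>\<close>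
that this yields compensates the derivative of the kernel (\<open>commutator_bound\<close>, \<open>sqnorm_corr_Lipschitz_le\<close>).
Since \<open>A\<close> and \<open>B\<close> have equal norms and \<open>\<bar>\<mu>\<bar> \<le> k < 1\<close>, the norm of \<open>B\<close> is bounded, and
therefore so is the norm of the mixed derivative \<open>\<rho>\<^sub>x\<^sub>y * g\<close> (\<open>mixed_derivative_bound\<close>).

The second ingredient is that in the plane a bound on the first derivatives and on the mixed second
derivative in \<open>L\<^sup>2\<close> gives Hoelder continuity of exponent \<open>1/2\<close>. The increment of \<open>u\<close> along a horizontal segment
of length \<open>a\<close> equals the integral of \<open>u\<^sub>x - (1 - y) u\<^sub>x\<^sub>y\<close> over the rectangle of height \<open>1\<close> above that segment, and the
Cauchy-Schwarz inequality bounds it by \<open>sqrt a\<close> times the norms (\<open>increment_x\<close>, \<open>increment_y\<close>).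

Finally the bumps \<open>r\<close> are let tend to the normalised indicator of \<open>[0, h]\<close>. The estimate passes to
the averages of \<open>g\<close> over squares of side \<open>h\<close>, and by Lebesgue's differentiation theorem these tend to
\<open>g\<close> almost everywhere as \<open>h\<close> tends to 0. Hence \<open>g\<close> is uniformly continuous off a null set and extends.\<close>

section \<open>Correlation with a kernel\<close>

text \<open>The square of the \<open>L\<^sup>2\<close> norm, with extended values so that it can be estimated by Tonelli's theorem before it is known
to be finite.\<close>

definition sqnorm :: "(complex \<Rightarrow> complex) \<Rightarrow> ennreal" where
  "sqnorm f = (\<integral>\<^sup>+z. (ennreal (cmod (f z)))\<^sup>2 \<partial>lborel)"

definition square_integrable :: "(complex \<Rightarrow> complex) \<Rightarrow> bool" where
  "square_integrable f \<longleftrightarrow> f \<in> borel_measurable borel \<and> sqnorm f < \<infinity>"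

definition locally_integrable :: "(complex \<Rightarrow> complex) \<Rightarrow> bool" where
  "locally_integrable f \<longleftrightarrow> f \<in> borel_measurable borel \<and> (\<forall>R. set_integrable lborel (cball 0 R) f)"

definition cc_kernel :: "(complex \<Rightarrow> complex) \<Rightarrow> bool" where
  "cc_kernel k \<longleftrightarrow> continuous_on UNIV k \<and> (\<exists>R. \<forall>t. cmod t > R \<longrightarrow> k t = 0)"

text \<open>For even kernels this is convolution. With this sign, \<open>corr k f z\<close> is the pairing of \<open>f\<close> with
the translate of \<open>k\<close> to \<open>z\<close>, so that a weak equation tested with all translates of \<open>k\<close> becomes a pointwise
identity between correlations.\<close>

definition corr :: "(complex \<Rightarrow> complex) \<Rightarrow> (complex \<Rightarrow> complex) \<Rightarrow> complex \<Rightarrow> complex" where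
  "corr k f z = (\<integral>t. k (t - z) * f t \<partial>lborel)"

lemma cball_borel [measurable]: "cball (z::complex) R \<in> sets borel"
  by simp

lemma nn_integral_complex_reflect:
  fixes \<kappa> :: "complex \<Rightarrow> ennreal"
  assumes [measurable]: "\<kappa> \<in> borel_measurable borel"
  shows "(\<integral>\<^sup>+z. \<kappa> (t - z) \<partial>lborel) = (\<integral>\<^sup>+z. \<kappa> z \<partial>lborel)"
proof -
  have "lborel = distr lborel borel (\<lambda>x. t - x)"
    using lborel_affine[of "-1" t] by (simp add: density_1 flip: one_ennreal_def)
  then have "(\<integral>\<^sup>+z. \<kappa> z \<partial>lborel) = (\<integral>\<^sup>+z. \<kappa> z \<partial>distr lborel borel (\<lambda>x. t - x))"
    by simp
  also have "\<dots> = (\<integral>\<^sup>+z. \<kappa> (t - z) \<partial>lborel)"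
    by (subst nn_integral_distr) auto
  finally show ?thesis by simp
qed

lemma nn_integral_complex_shift:
  fixes \<kappa> :: "complex \<Rightarrow> ennreal"
  assumes [measurable]: "\<kappa> \<in> borel_measurable borel"
  shows "(\<integral>\<^sup>+z. \<kappa> (z + t) \<partial>lborel) = (\<integral>\<^sup>+z. \<kappa> z \<partial>lborel)"
proof -
  have "(\<integral>\<^sup>+z. \<kappa> z \<partial>lborel) = (\<integral>\<^sup>+z. \<kappa> z \<partial>distr lborel borel ((+) t))"
    by (simp add: lborel_distr_plus)
  also have "\<dots> = (\<integral>\<^sup>+z. \<kappa> (z + t) \<partial>lborel)"
    by (subst nn_integral_distr) (auto simp: add.commute)
  finally show ?thesis by simp
qed

text \<open>This is the Cauchy-Schwarz inequality for the functions \<open>1\<close> and \<open>f\<close> and the measure with density \<open>\<kappa>\<close>.\<close>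

lemma weighted_Cauchy_Schwarz:
  fixes \<kappa> f :: "complex \<Rightarrow> ennreal"
  assumes [measurable]: "\<kappa> \<in> borel_measurable borel" "f \<in> borel_measurable borel"
  shows "(\<integral>\<^sup>+t. \<kappa> t * f t \<partial>lborel)\<^sup>2 \<le> (\<integral>\<^sup>+t. \<kappa> t \<partial>lborel) * (\<integral>\<^sup>+t. \<kappa> t * (f t)\<^sup>2 \<partial>lborel)"
  using Cauchy_Schwarz_nn_integral[of "\<lambda>_. 1" "density lborel \<kappa>" f]
  by (simp add: nn_integral_density emeasure_density)

text \<open>Young's inequality for an \<open>L\<^sup>1\<close> kernel acting on \<open>L\<^sup>2\<close>. The weighted Cauchy-Schwarz inequality bounds
the inner square by \<open>\<integral>\<kappa>\<close> times the correlation of \<open>\<kappa>\<close> with \<open>f\<^sup>2\<close>; Tonelli's theorem then yields a second factor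
\<open>\<integral>\<kappa>\<close>.\<close>

lemma nn_Young:
  fixes \<kappa> f :: "complex \<Rightarrow> ennreal"
  assumes [measurable]: "\<kappa> \<in> borel_measurable borel" "f \<in> borel_measurable borel"
  shows "(\<integral>\<^sup>+z. (\<integral>\<^sup>+t. \<kappa> (t - z) * f t \<partial>lborel)\<^sup>2 \<partial>lborel)
    \<le> (\<integral>\<^sup>+t. \<kappa> t \<partial>lborel)\<^sup>2 * (\<integral>\<^sup>+t. (f t)\<^sup>2 \<partial>lborel)"
proof -
  let ?K = "\<integral>\<^sup>+t. \<kappa> t \<partial>lborel"
  have K: "(\<integral>\<^sup>+t. \<kappa> (t - z) \<partial>lborel) = ?K" for z
    using nn_integral_complex_shift[of \<kappa> "-z"] by simp
  have "(\<integral>\<^sup>+z. (\<integral>\<^sup>+t. \<kappa> (t - z) * f t \<partial>lborel)\<^sup>2 \<partial>lborel)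
    \<le> (\<integral>\<^sup>+z. ?K * (\<integral>\<^sup>+t. \<kappa> (t - z) * (f t)\<^sup>2 \<partial>lborel) \<partial>lborel)"
  proof (rule nn_integral_mono)
    fix z
    show "(\<integral>\<^sup>+t. \<kappa> (t - z) * f t \<partial>lborel)\<^sup>2 \<le> ?K * (\<integral>\<^sup>+t. \<kappa> (t - z) * (f t)\<^sup>2 \<partial>lborel)"
      using weighted_Cauchy_Schwarz[of "\<lambda>t. \<kappa> (t - z)" f] by (simp add: K)
  qed
  also have "\<dots> = ?K * (\<integral>\<^sup>+z. \<integral>\<^sup>+t. \<kappa> (t - z) * (f t)\<^sup>2 \<partial>lborel \<partial>lborel)"
    by (rule nn_integral_cmult) measurable
  also have "(\<integral>\<^sup>+z. \<integral>\<^sup>+t. \<kappa> (t - z) * (f t)\<^sup>2 \<partial>lborel \<partial>lborel)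
     = (\<integral>\<^sup>+t. \<integral>\<^sup>+z. \<kappa> (t - z) * (f t)\<^sup>2 \<partial>lborel \<partial>lborel)"
    by (rule lborel_pair.Fubini') measurable
  also have "\<dots> = (\<integral>\<^sup>+t. ?K * (f t)\<^sup>2 \<partial>lborel)"
    by (intro nn_integral_cong) (simp add: nn_integral_multc nn_integral_complex_reflect)
  also have "\<dots> = ?K * (\<integral>\<^sup>+t. (f t)\<^sup>2 \<partial>lborel)"
    by (rule nn_integral_cmult) measurable
  finally show ?thesis by (simp add: power2_eq_square mult.assoc)
qed

lemma cc_kernelD:
  assumes "cc_kernel k"
  shows "k \<in> borel_measurable borel" "continuous_on UNIV k"
    "\<exists>R B. 0 \<le> B \<and> 0 \<le> R \<and> (\<forall>t. cmod (k t) \<le> B * indicator (cball 0 R) t)"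
proof -
  from assms obtain R where c: "continuous_on UNIV k" and R: "\<And>t. cmod t > R \<Longrightarrow> k t = 0"
    unfolding cc_kernel_def by auto
  show "k \<in> borel_measurable borel" "continuous_on UNIV k"
    using c by (auto intro: borel_measurable_continuous_onI)
  have "compact (k ` cball 0 \<bar>R\<bar>)"
    by (intro compact_continuous_image continuous_on_subset[OF c]) auto
  then obtain B where B: "\<And>t. t \<in> cball 0 \<bar>R\<bar> \<Longrightarrow> cmod (k t) \<le> B"
    by (meson bounded_iff compact_imp_bounded imageI)
  have "cmod (k t) \<le> \<bar>B\<bar> * indicator (cball 0 \<bar>R\<bar>) t" for t
  proof (cases "t \<in> cball 0 \<bar>R\<bar>")
    case True
    then show ?thesis using B[OF True] by simp
  next
    case False
    then show ?thesis using R[of t] by simp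
  qed
  then show "\<exists>R B. 0 \<le> B \<and> 0 \<le> R \<and> (\<forall>t. cmod (k t) \<le> B * indicator (cball 0 R) t)"
    by (intro exI[of _ "\<bar>R\<bar>"] exI[of _ "\<bar>B\<bar>"]) auto
qed

lemma cc_kernel_shift:
  assumes "cc_kernel k" shows "cc_kernel (\<lambda>t. k (t - z))"
proof -
  from assms obtain R where c: "continuous_on UNIV k" and R: "\<And>t. cmod t > R \<Longrightarrow> k t = 0"
    unfolding cc_kernel_def by auto
  have "continuous_on UNIV (\<lambda>t. k (t - z))"
    by (rule continuous_on_compose2[OF c]) (auto intro!: continuous_intros)
  moreover have "k (t - z) = 0" if "cmod t > R + cmod z" for t
    using that norm_triangle_ineq2[of t z] by (intro R) auto
  ultimately show ?thesis unfolding cc_kernel_def by blast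
qed

lemma integrable_cc_mult:
  assumes "cc_kernel k" "locally_integrable f"
  shows "integrable lborel (\<lambda>t. k t * f t)"
proof -
  from cc_kernelD(3)[OF assms(1)] obtain R B where RB: "0 \<le> B" "\<And>t. cmod (k t) \<le> B * indicator (cball 0 R) t"
    by blast
  have [measurable]: "k \<in> borel_measurable borel" "f \<in> borel_measurable borel"
    using cc_kernelD[OF assms(1)] assms(2) unfolding locally_integrable_def by auto
  have "integrable lborel (\<lambda>t. B * norm (indicator (cball 0 R) t *\<^sub>R f t))"
    using assms(2) unfolding locally_integrable_def set_integrable_def
    by (intro integrable_mult_right integrable_norm) auto
  then show ?thesis
  proof (rule Bochner_Integration.integrable_bound)
    show "AE t in lborel. norm (k t * f t) \<le> norm (B * norm (indicator (cball 0 R) t *\<^sub>R f t))"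
    proof (rule AE_I2)
      fix t
      have "norm (k t * f t) \<le> (B * indicator (cball 0 R) t) * norm (f t)"
        using RB(2)[of t] by (simp add: norm_mult mult_right_mono)
      also have "\<dots> = norm (B * norm (indicator (cball 0 R) t *\<^sub>R f t))"
        using RB(1) by (simp add: abs_mult)
      finally show "norm (k t * f t) \<le> norm (B * norm (indicator (cball 0 R) t *\<^sub>R f t))" .
    qed
  qed simp
qed

lemma integrable_corr:
  assumes "cc_kernel k" "locally_integrable f"
  shows "integrable lborel (\<lambda>t. k (t - z) * f t)"
  using integrable_cc_mult[OF cc_kernel_shift[OF assms(1)] assms(2)] .

lemma square_integrable_imp_locally_integrable:
  assumes "square_integrable f"
  shows "locally_integrable f"
  unfolding locally_integrable_def
proof (intro conjI allI)
  show [measurable]: "f \<in> borel_measurable borel" using assms unfolding square_integrable_def by auto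
  fix R :: real
  have "(\<integral>\<^sup>+t. ennreal (norm (indicator (cball 0 R) t *\<^sub>R f t)) \<partial>lborel)
    \<le> (\<integral>\<^sup>+t. indicator (cball (0::complex) R) t + (ennreal (cmod (f t)))\<^sup>2 \<partial>lborel)"
  proof (rule nn_integral_mono)
    fix t
    have "x \<le> 1 + x\<^sup>2" for x :: real
      using sum_squares_bound[of 1 x] by (sos)
    then have "ennreal (cmod (f t)) \<le> ennreal (1 + (cmod (f t))\<^sup>2)" by (intro ennreal_leI) 
    also have "\<dots> = 1 + (ennreal (cmod (f t)))\<^sup>2" by (simp add: ennreal_plus ennreal_power)
    finally show "ennreal (norm (indicator (cball 0 R) t *\<^sub>R f t))
      \<le> indicator (cball 0 R) t + (ennreal (cmod (f t)))\<^sup>2"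
      by (auto split: split_indicator)
  qed
  also have "\<dots> = emeasure lborel (cball (0::complex) R) + sqnorm f"
    by (subst nn_integral_add) (simp_all add: sqnorm_def)
  also have "\<dots> < \<infinity>"
    using assms emeasure_bounded_finite[of "cball (0::complex) R"]
    unfolding square_integrable_def by (auto simp: ennreal_add_less_top)
  finally show "set_integrable lborel (cball 0 R) f"
    unfolding set_integrable_def by (intro integrableI_bounded) auto
qed

lemma corr_measurable [measurable]:
  assumes [measurable]: "k \<in> borel_measurable borel" "f \<in> borel_measurable borel"
  shows "corr k f \<in> borel_measurable borel"
  unfolding corr_def by measurable

lemma corr_norm_le:
  "ennreal (cmod (corr k f z)) \<le> (\<integral>\<^sup>+t. ennreal (cmod (k (t - z))) * ennreal (cmod (f t)) \<partial>lborel)"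
proof (cases "integrable lborel (\<lambda>t. k (t - z) * f t)")
  case True
  then have "ennreal (cmod (corr k f z)) \<le> (\<integral>\<^sup>+t. ennreal (cmod (k (t - z) * f t)) \<partial>lborel)"
    unfolding corr_def by (rule integral_norm_bound_ennreal)
  then show ?thesis by (simp add: norm_mult ennreal_mult)
qed (simp add: corr_def not_integrable_integral_eq)

lemma sqnorm_corr_le:
  assumes [measurable]: "k \<in> borel_measurable borel" "f \<in> borel_measurable borel"
  shows "sqnorm (corr k f) \<le> (\<integral>\<^sup>+t. ennreal (cmod (k t)) \<partial>lborel)\<^sup>2 * sqnorm f"
proof -
  have "sqnorm (corr k f)
    \<le> (\<integral>\<^sup>+z. (\<integral>\<^sup>+t. ennreal (cmod (k (t - z))) * ennreal (cmod (f t)) \<partial>lborel)\<^sup>2 \<partial>lborel)"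
    unfolding sqnorm_def by (intro nn_integral_mono power_mono corr_norm_le) simp
  also have "\<dots> \<le> (\<integral>\<^sup>+t. ennreal (cmod (k t)) \<partial>lborel)\<^sup>2 * sqnorm f"
    unfolding sqnorm_def by (rule nn_Young) measurable
  finally show ?thesis .
qed

lemma cc_kernel_nn_integral_finite:
  assumes "cc_kernel k"
  shows "(\<integral>\<^sup>+t. ennreal (cmod (k t)) \<partial>lborel) < \<infinity>"
proof -
  from cc_kernelD(3)[OF assms(1)] obtain R B where RB: "0 \<le> B" "\<And>t. cmod (k t) \<le> B * indicator (cball 0 R) t"
    by blast
  have "(\<integral>\<^sup>+t. ennreal (cmod (k t)) \<partial>lborel) \<le> (\<integral>\<^sup>+t. ennreal B * indicator (cball (0::complex) R) t \<partial>lborel)"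
  proof (rule nn_integral_mono)
    fix t show "ennreal (cmod (k t)) \<le> ennreal B * indicator (cball 0 R) t"
      using ennreal_leI[OF RB(2)[of t]] by (auto split: split_indicator)
  qed
  also have "\<dots> = ennreal B * emeasure lborel (cball (0::complex) R)"
    by (subst nn_integral_cmult) simp_all
  also have "\<dots> < \<infinity>"
    using emeasure_bounded_finite[of "cball (0::complex) R"] by (auto simp: ennreal_mult_less_top)
  finally show ?thesis .
qed

lemma square_integrable_corr:
  assumes "cc_kernel k" "square_integrable f"
  shows "square_integrable (corr k f)"
proof -
  have [measurable]: "k \<in> borel_measurable borel" "f \<in> borel_measurable borel"
    using cc_kernelD[OF assms(1)] assms(2) unfolding square_integrable_def by auto
  have "sqnorm (corr k f) \<le> (\<integral>\<^sup>+t. ennreal (cmod (k t)) \<partial>lborel)\<^sup>2 * sqnorm f"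
    by (rule sqnorm_corr_le) measurable
  also have "\<dots> < \<infinity>"
    using assms(2) cc_kernel_nn_integral_finite[OF assms(1)]
    unfolding square_integrable_def by (auto simp: ennreal_mult_less_top power2_eq_square)
  finally show ?thesis unfolding square_integrable_def by simp
qed

section \<open>The plane as a product, and two applications of Fubini's theorem\<close>

lemma Complex_measurable [measurable]:
  "(\<lambda>(x, y). Complex x y) \<in> borel_measurable (lborel \<Otimes>\<^sub>M lborel)"
  unfolding Complex_eq case_prod_beta by measurable

lemma lborel_complex_eq_distr:
  "(lborel :: complex measure) = distr (lborel \<Otimes>\<^sub>M lborel) borel (\<lambda>(x, y). Complex x y)"
proof (rule lborel_eqI)
  fix l u :: complex assume lu: "\<And>b. b \<in> Basis \<Longrightarrow> l \<bullet> b \<le> u \<bullet> b"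
  have le: "Re l \<le> Re u" "Im l \<le> Im u"
    using lu[of 1] lu[of \<i>] by (auto simp: Basis_complex_def inner_complex_def)
  have "(\<lambda>(x, y). Complex x y) -` box l u \<inter> space (lborel \<Otimes>\<^sub>M lborel)
      = box (Re l) (Re u) \<times> box (Im l) (Im u)"
    by (auto simp: in_box_complex_iff space_pair_measure)
  then have "emeasure (distr (lborel \<Otimes>\<^sub>M lborel) borel (\<lambda>(x, y). Complex x y)) (box l u)
      = emeasure (lborel \<Otimes>\<^sub>M lborel) (box (Re l) (Re u) \<times> box (Im l) (Im u))"
    by (subst emeasure_distr) auto
  also have "\<dots> = ennreal (Re u - Re l) * ennreal (Im u - Im l)"
    using le by (subst lborel.emeasure_pair_measure_Times) auto
  also have "\<dots> = ennreal (\<Prod>b\<in>Basis. (u - l) \<bullet> b)"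
    using le by (simp add: Basis_complex_def inner_complex_def ennreal_mult)
  finally show "emeasure (distr (lborel \<Otimes>\<^sub>M lborel) borel (\<lambda>(x, y). Complex x y)) (box l u)
    = ennreal (\<Prod>b\<in>Basis. (u - l) \<bullet> b)" .
qed simp

lemma nn_integral_complex_product:
  fixes p q :: "real \<Rightarrow> ennreal"
  assumes [measurable]: "p \<in> borel_measurable borel" "q \<in> borel_measurable borel"
  shows "(\<integral>\<^sup>+z. p (Re z) * q (Im z) \<partial>lborel) = (\<integral>\<^sup>+x. p x \<partial>lborel) * (\<integral>\<^sup>+y. q y \<partial>lborel)"
proof -
  have "(\<integral>\<^sup>+z. p (Re z) * q (Im z) \<partial>lborel)
      = (\<integral>\<^sup>+xy. p (fst xy) * q (snd xy) \<partial>(lborel \<Otimes>\<^sub>M lborel))"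
    by (subst lborel_complex_eq_distr, subst nn_integral_distr) (auto simp: case_prod_beta)
  also have "\<dots> = (\<integral>\<^sup>+x. \<integral>\<^sup>+y. p x * q y \<partial>lborel \<partial>lborel)"
    by (subst lborel.nn_integral_fst[symmetric]) auto
  finally show ?thesis by (simp add: nn_integral_cmult nn_integral_multc)
qed

lemma integrable_product_pair:
  fixes f :: "'a::euclidean_space \<Rightarrow> complex" and g :: "'b::euclidean_space \<Rightarrow> complex"
  assumes f: "integrable lborel f" and g: "integrable lborel g"
  shows "integrable (lborel \<Otimes>\<^sub>M lborel) (\<lambda>(x, y). f x * g y)"
proof (rule integrableI_bounded)
  have [measurable]: "f \<in> borel_measurable borel" "g \<in> borel_measurable borel"
    using f g by (auto dest: borel_measurable_integrable)
  show "(\<lambda>(x, y). f x * g y) \<in> borel_measurable (lborel \<Otimes>\<^sub>M lborel)" by measurable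
  have "(\<integral>\<^sup>+xy. ennreal (norm (case xy of (x, y) \<Rightarrow> f x * g y)) \<partial>(lborel \<Otimes>\<^sub>M lborel))
      = (\<integral>\<^sup>+x. \<integral>\<^sup>+y. ennreal (norm (f x)) * ennreal (norm (g y)) \<partial>lborel \<partial>lborel)"
    by (subst lborel.nn_integral_fst[symmetric]) (auto simp: norm_mult ennreal_mult)
  also have "\<dots> = (\<integral>\<^sup>+x. ennreal (norm (f x)) \<partial>lborel) * (\<integral>\<^sup>+y. ennreal (norm (g y)) \<partial>lborel)"
    by (simp add: nn_integral_cmult nn_integral_multc)
  also have "\<dots> < \<infinity>"
    using f g by (simp add: integrable_iff_bounded ennreal_mult_less_top)
  finally show "(\<integral>\<^sup>+xy. ennreal (norm (case xy of (x, y) \<Rightarrow> f x * g y)) \<partial>(lborel \<Otimes>\<^sub>M lborel)) < \<infinity>" .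
qed

lemma integral_product_pair:
  fixes f :: "'a::euclidean_space \<Rightarrow> complex" and g :: "'b::euclidean_space \<Rightarrow> complex"
  assumes f: "integrable lborel f" and g: "integrable lborel g"
  shows "(\<integral>(x, y). f x * g y \<partial>(lborel \<Otimes>\<^sub>M lborel)) = (\<integral>x. f x \<partial>lborel) * (\<integral>y. g y \<partial>lborel)"
  by (subst lborel_pair.integral_fst'[OF integrable_product_pair[OF f g], symmetric]) simp

lemma integral_complex_product:
  fixes p q :: "real \<Rightarrow> complex"
  assumes p: "integrable lborel p" and q: "integrable lborel q"
  shows "(\<integral>z. p (Re z) * q (Im z) \<partial>lborel) = (\<integral>x. p x \<partial>lborel) * (\<integral>y. q y \<partial>lborel)"
proof -
  have [measurable]: "p \<in> borel_measurable borel" "q \<in> borel_measurable borel"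
    using p q by (auto dest: borel_measurable_integrable)
  have "(\<integral>z. p (Re z) * q (Im z) \<partial>lborel) = (\<integral>(x, y). p x * q y \<partial>(lborel \<Otimes>\<^sub>M lborel))"
    by (subst lborel_complex_eq_distr, subst integral_distr) (simp_all add: case_prod_beta')
  then show ?thesis by (simp add: integral_product_pair[OF p q])
qed

text \<open>In the pairing of two correlations the variable \<open>z\<close> can be integrated first. What remains depends on the
two kernels only through \<open>\<integral> a (s - z) b (t - z) dz\<close>, so an identity between such integrals gives an
identity between pairings, for arbitrary \<open>f\<close> and \<open>g\<close>. The triple integral converges absolutely by Young's inequality.\<close>

lemma integral_corr_mult_corr:
  assumes a: "cc_kernel a" and b: "cc_kernel b" and f: "square_integrable f" and g: "square_integrable g"
  shows "(\<integral>z. corr a f z * corr b g z \<partial>lborel)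
    = (\<integral>(s, t). (\<integral>z. a (s - z) * b (t - z) \<partial>lborel) * (f s * g t) \<partial>(lborel \<Otimes>\<^sub>M lborel))"
proof -
  have [measurable]: "a \<in> borel_measurable borel" "b \<in> borel_measurable borel"
     "f \<in> borel_measurable borel" "g \<in> borel_measurable borel"
    using cc_kernelD[OF a] cc_kernelD[OF b] f g unfolding square_integrable_def by auto
  let ?H = "\<lambda>z st. a (fst st - z) * b (snd st - z) * (f (fst st) * g (snd st))"
  let ?A = "\<lambda>z. \<integral>\<^sup>+s. ennreal (cmod (a (s - z))) * ennreal (cmod (f s)) \<partial>lborel"
  let ?B = "\<lambda>z. \<integral>\<^sup>+s. ennreal (cmod (b (s - z))) * ennreal (cmod (g s)) \<partial>lborel"
  have young: "(\<integral>\<^sup>+z. (?A z)\<^sup>2 \<partial>lborel) < \<infinity>" "(\<integral>\<^sup>+z. (?B z)\<^sup>2 \<partial>lborel) < \<infinity>"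
    using f g cc_kernel_nn_integral_finite[OF a] cc_kernel_nn_integral_finite[OF b]
    unfolding square_integrable_def sqnorm_def
    by (intro le_less_trans[OF nn_Young]; simp add: power_less_top_ennreal ennreal_mult_less_top)+
  have sf: "sigma_finite_measure (lborel \<Otimes>\<^sub>M lborel :: (complex \<times> complex) measure)"
    unfolding lborel_prod ..
  interpret P: pair_sigma_finite "lborel :: complex measure" "lborel \<Otimes>\<^sub>M lborel :: (complex \<times> complex) measure" ..
  have int: "integrable (lborel \<Otimes>\<^sub>M (lborel \<Otimes>\<^sub>M lborel)) (\<lambda>(z, st). ?H z st)"
  proof (rule integrableI_bounded)
    have "(\<integral>\<^sup>+zst. ennreal (norm (case zst of (z, st) \<Rightarrow> ?H z st)) \<partial>(lborel \<Otimes>\<^sub>M (lborel \<Otimes>\<^sub>M lborel)))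
      = (\<integral>\<^sup>+z. \<integral>\<^sup>+st. ennreal (norm (?H z st)) \<partial>(lborel \<Otimes>\<^sub>M lborel) \<partial>lborel)"
      by (subst sigma_finite_measure.nn_integral_fst[OF sf, symmetric]) auto
    also have "\<dots> = (\<integral>\<^sup>+z. ?A z * ?B z \<partial>lborel)"
    proof (rule nn_integral_cong)
      fix z :: complex
      have "(\<integral>\<^sup>+st. ennreal (norm (?H z st)) \<partial>(lborel \<Otimes>\<^sub>M lborel))
        = (\<integral>\<^sup>+s. \<integral>\<^sup>+t. (ennreal (cmod (a (s - z))) * ennreal (cmod (f s))) *
              (ennreal (cmod (b (t - z))) * ennreal (cmod (g t))) \<partial>lborel \<partial>lborel)"
        by (subst lborel.nn_integral_fst[symmetric]) (auto simp: norm_mult ennreal_mult ac_simps)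
      also have "\<dots> = ?A z * ?B z"
        by (simp add: nn_integral_cmult nn_integral_multc)
      finally show "(\<integral>\<^sup>+st. ennreal (norm (?H z st)) \<partial>(lborel \<Otimes>\<^sub>M lborel)) = ?A z * ?B z" .
    qed
    also have "\<dots> < \<infinity>"
    proof -
      have "(\<integral>\<^sup>+z. ?A z * ?B z \<partial>lborel)\<^sup>2 \<le> (\<integral>\<^sup>+z. (?A z)\<^sup>2 \<partial>lborel) * (\<integral>\<^sup>+z. (?B z)\<^sup>2 \<partial>lborel)"
        by (rule Cauchy_Schwarz_nn_integral) measurable
      also have "\<dots> < \<infinity>" using young by (simp add: ennreal_mult_less_top)
      finally show ?thesis by (simp add: power_less_top_ennreal)
    qed
    finally show "(\<integral>\<^sup>+zst. ennreal (norm (case zst of (z, st) \<Rightarrow> ?H z st)) \<partial>(lborel \<Otimes>\<^sub>M (lborel \<Otimes>\<^sub>M lborel))) < \<infinity>" .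
  qed measurable
  have "corr a f z * corr b g z = (\<integral>st. ?H z st \<partial>(lborel \<Otimes>\<^sub>M lborel))" for z
    using integral_product_pair[OF integrable_corr[OF a square_integrable_imp_locally_integrable[OF f], of z]
        integrable_corr[OF b square_integrable_imp_locally_integrable[OF g], of z]]
    unfolding corr_def by (simp add: case_prod_beta' ac_simps)
  then have "(\<integral>z. corr a f z * corr b g z \<partial>lborel) = (\<integral>z. \<integral>st. ?H z st \<partial>(lborel \<Otimes>\<^sub>M lborel) \<partial>lborel)"
    by simp
  also have "\<dots> = (\<integral>st. \<integral>z. ?H z st \<partial>lborel \<partial>(lborel \<Otimes>\<^sub>M lborel))"
    by (rule P.Fubini_integral[symmetric, OF int])
  finally show ?thesis by (simp add: case_prod_beta')
qed

text \<open>If the kernel is itself an average over \<open>\<zeta> \<in> S\<close> of translates of \<open>k\<close>, then its pairing with \<open>g\<close> is the average of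
\<open>corr k g\<close> over \<open>z + S\<close>, and the Cauchy-Schwarz inequality bounds the latter pointwise by an \<open>L\<^sup>2\<close> norm.
This is how \<open>L\<^sup>2\<close> bounds are turned into pointwise ones.\<close>

lemma weighted_average_bound:
  fixes c :: "complex \<Rightarrow> complex"
  assumes c[measurable]: "c \<in> borel_measurable borel" and cS: "\<And>\<zeta>. cmod (c \<zeta>) \<le> indicator S \<zeta>"
    and S: "bounded S" and S_borel[measurable]: "S \<in> sets borel"
    and k: "cc_kernel k" and g: "locally_integrable g"
  shows "integrable lborel (\<lambda>t. (\<integral>\<zeta>. c \<zeta> * k (t - (z + \<zeta>)) \<partial>lborel) * g t)"
    and "(ennreal (cmod (\<integral>t. (\<integral>\<zeta>. c \<zeta> * k (t - (z + \<zeta>)) \<partial>lborel) * g t \<partial>lborel)))\<^sup>2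
    \<le> emeasure lborel S * sqnorm (corr k g)" (is "?bound")
proof -
  have [measurable]: "k \<in> borel_measurable borel" "g \<in> borel_measurable borel"
    using cc_kernelD[OF k] g unfolding locally_integrable_def by auto
  from cc_kernelD(3)[OF k] obtain R B where RB: "0 \<le> B" "\<And>t. cmod (k t) \<le> B * indicator (cball 0 R) t"
    by blast
  from S obtain R' where R': "\<And>\<zeta>. \<zeta> \<in> S \<Longrightarrow> cmod \<zeta> \<le> R'" by (auto simp: bounded_iff)
  let ?K = "cball (0::complex) (R + cmod z + R')"
  have fin: "emeasure lborel S < \<infinity>" using S by (rule emeasure_bounded_finite)
  have "integrable lborel (\<lambda>\<zeta>. of_real (indicator S \<zeta>) :: complex)"
    using fin by (intro integrable_of_real integrable_real_indicator) auto
  moreover have "integrable lborel (\<lambda>t. B * (indicator ?K t *\<^sub>R g t))"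
    using g unfolding locally_integrable_def set_integrable_def
    by (intro integrable_mult_right) blast
  ultimately have "integrable (lborel \<Otimes>\<^sub>M lborel)
      (\<lambda>(\<zeta>, t). of_real (indicator S \<zeta>) * (B * (indicator ?K t *\<^sub>R g t)))"
    by (rule integrable_product_pair)
  then have int: "integrable (lborel \<Otimes>\<^sub>M lborel) (\<lambda>(\<zeta>, t). c \<zeta> * k (t - (z + \<zeta>)) * g t)"
  proof (rule Bochner_Integration.integrable_bound)
    have "norm (c \<zeta> * k (t - (z + \<zeta>)) * g t) \<le> norm (of_real (indicator S \<zeta>) * (B * (indicator ?K t *\<^sub>R g t)))" for \<zeta> t
    proof (cases "\<zeta> \<in> S \<and> t \<in> ?K")
      case True
      have "cmod (c \<zeta>) * cmod (k (t - (z + \<zeta>))) \<le> 1 * B"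
        using cS[of \<zeta>] RB(2)[of "t - (z + \<zeta>)"] True RB(1)
        by (intro mult_mono) (auto split: split_indicator_asm)
      then show ?thesis using True RB(1) by (simp add: norm_mult mult_right_mono)
    next
      case False
      have "c \<zeta> * k (t - (z + \<zeta>)) = 0"
      proof (cases "\<zeta> \<in> S")
        case True
        with False have "t \<notin> ?K" by auto
        then have "cmod t > R + cmod z + R'" by simp
        then have "cmod (t - (z + \<zeta>)) > R"
          using R'[OF True] norm_triangle_ineq2[of t "z + \<zeta>"] norm_triangle_ineq[of z \<zeta>] by linarith
        then show ?thesis using RB(2)[of "t - (z + \<zeta>)"] by simp
      next
        case False
        then show ?thesis using cS[of \<zeta>] by simp
      qed
      then have "c \<zeta> * k (t - (z + \<zeta>)) * g t = 0" by simp
      then show ?thesis by (metis norm_ge_zero norm_zero)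
    qed
    then show "AE x in lborel \<Otimes>\<^sub>M lborel. norm (case x of (\<zeta>, t) \<Rightarrow> c \<zeta> * k (t - (z + \<zeta>)) * g t)
        \<le> norm (case x of (\<zeta>, t) \<Rightarrow> of_real (indicator S \<zeta>) * (B * (indicator ?K t *\<^sub>R g t)))"
      by (intro AE_I2) auto
  qed measurable
  show "integrable lborel (\<lambda>t. (\<integral>\<zeta>. c \<zeta> * k (t - (z + \<zeta>)) \<partial>lborel) * g t)"
    using lborel_pair.integrable_snd[OF int] by simp
  have "(\<integral>t. (\<integral>\<zeta>. c \<zeta> * k (t - (z + \<zeta>)) \<partial>lborel) * g t \<partial>lborel)
     = (\<integral>t. (\<integral>\<zeta>. c \<zeta> * k (t - (z + \<zeta>)) * g t \<partial>lborel) \<partial>lborel)"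
    by simp
  also have "\<dots> = (\<integral>\<zeta>. (\<integral>t. c \<zeta> * k (t - (z + \<zeta>)) * g t \<partial>lborel) \<partial>lborel)"
    by (rule lborel_pair.Fubini_integral[OF int])
  also have "\<dots> = (\<integral>\<zeta>. c \<zeta> * corr k g (z + \<zeta>) \<partial>lborel)"
    by (simp add: corr_def mult.assoc)
  finally have eq: "(\<integral>t. (\<integral>\<zeta>. c \<zeta> * k (t - (z + \<zeta>)) \<partial>lborel) * g t \<partial>lborel)
     = (\<integral>\<zeta>. c \<zeta> * corr k g (z + \<zeta>) \<partial>lborel)" .
  have "ennreal (cmod (\<integral>\<zeta>. c \<zeta> * corr k g (z + \<zeta>) \<partial>lborel))
      \<le> (\<integral>\<^sup>+\<zeta>. ennreal (cmod (c \<zeta> * corr k g (z + \<zeta>))) \<partial>lborel)"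
  proof (cases "integrable lborel (\<lambda>\<zeta>. c \<zeta> * corr k g (z + \<zeta>))")
    case True
    then show ?thesis by (rule integral_norm_bound_ennreal)
  qed (simp add: not_integrable_integral_eq)
  also have "\<dots> \<le> (\<integral>\<^sup>+\<zeta>. indicator S \<zeta> * ennreal (cmod (corr k g (z + \<zeta>))) \<partial>lborel)"
  proof (rule nn_integral_mono)
    fix \<zeta>
    show "ennreal (cmod (c \<zeta> * corr k g (z + \<zeta>))) \<le> indicator S \<zeta> * ennreal (cmod (corr k g (z + \<zeta>)))"
      using cS[of \<zeta>] by (auto simp: norm_mult split: split_indicator_asm intro!: ennreal_leI mult_left_le_one_le)
  qed
  finally have "(ennreal (cmod (\<integral>\<zeta>. c \<zeta> * corr k g (z + \<zeta>) \<partial>lborel)))\<^sup>2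
      \<le> (\<integral>\<^sup>+\<zeta>. indicator S \<zeta> * ennreal (cmod (corr k g (z + \<zeta>))) \<partial>lborel)\<^sup>2"
    by (rule power_mono) simp
  also have "\<dots> \<le> (\<integral>\<^sup>+\<zeta>. (indicator S \<zeta>)\<^sup>2 \<partial>lborel) * (\<integral>\<^sup>+\<zeta>. (ennreal (cmod (corr k g (z + \<zeta>))))\<^sup>2 \<partial>lborel)"
    by (rule Cauchy_Schwarz_nn_integral) measurable
  also have "(\<integral>\<^sup>+\<zeta>. (indicator S \<zeta>)\<^sup>2 \<partial>lborel) = emeasure lborel S"
  proof -
    have "(indicator S \<zeta>)\<^sup>2 = (indicator S \<zeta> :: ennreal)" for \<zeta>
      by (simp split: split_indicator)
    then show ?thesis by simp
  qed
  also have "(\<integral>\<^sup>+\<zeta>. (ennreal (cmod (corr k g (z + \<zeta>))))\<^sup>2 \<partial>lborel) = sqnorm (corr k g)"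
    unfolding sqnorm_def
    using nn_integral_complex_shift[of "\<lambda>\<zeta>. (ennreal (cmod (corr k g \<zeta>)))\<^sup>2" z]
    by (simp add: add.commute)
  finally show ?bound unfolding eq .
qed

section \<open>Calculus of smooth functions\<close>

abbreviation smooth :: "(complex \<Rightarrow> complex) \<Rightarrow> bool" where
  "smooth f \<equiv> \<forall>n. C_k n f"

lemma partial_eqI: "(f has_derivative f') (at z) \<Longrightarrow> partial e f z = f' e"
  unfolding partial_def by (metis frechet_derivative_at)

lemma has_derivative_frechet:
  "f differentiable (at z) \<Longrightarrow> (f has_derivative frechet_derivative f (at z)) (at z)"
  by (simp add: frechet_derivative_works)

lemma C_k_const: "C_k n (\<lambda>_. c)"
proof (induction n arbitrary: c)
  case (Suc n)
  have "partial e (\<lambda>_. c) = (\<lambda>_. 0)" for e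
    by (rule ext, rule partial_eqI) (rule has_derivative_const)
  then show ?case using Suc by simp
qed simp

lemma C_k_add: "C_k n f \<Longrightarrow> C_k n g \<Longrightarrow> C_k n (\<lambda>z. f z + g z)"
proof (induction n arbitrary: f g)
  case (Suc n)
  have "partial e (\<lambda>z. f z + g z) = (\<lambda>z. partial e f z + partial e g z)" for e
    using Suc.prems unfolding partial_def[of _ f] partial_def[of _ g]
    by (intro ext partial_eqI) (auto intro!: has_derivative_add has_derivative_frechet)
  then show ?case using Suc by simp
qed (simp add: continuous_on_add)

lemma smooth_differentiable: "smooth f \<Longrightarrow> f differentiable (at z)"
  using C_k.simps(2) by blast

lemma smooth_partial: "smooth f \<Longrightarrow> smooth (partial 1 f)" "smooth f \<Longrightarrow> smooth (partial \<i> f)"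
  using C_k.simps(2) by blast+

lemma smooth_continuous: "smooth f \<Longrightarrow> continuous_on UNIV f"
  using C_k.simps(1) by blast

lemma partial_mult:
  assumes "f differentiable (at z)" "g differentiable (at z)"
  shows "partial e (\<lambda>z. f z * g z) z = f z * partial e g z + partial e f z * g z"
  using has_derivative_mult[OF has_derivative_frechet[OF assms(1)] has_derivative_frechet[OF assms(2)]]
  by (auto dest: partial_eqI simp: partial_def[of _ f] partial_def[of _ g])

text \<open>The induction is on the order of differentiation with both factors arbitrary smooth functions: by Leibniz' rule
the partial derivatives of the product are sums of products of smooth functions.\<close>

lemma smooth_mult:
  assumes "smooth f" "smooth g" shows "smooth (\<lambda>z. f z * g z)"
proof
  fix n show "C_k n (\<lambda>z. f z * g z)"
    using assms
  proof (induction n arbitrary: f g)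
    case 0
    then show ?case by (simp add: smooth_continuous continuous_on_mult)
  next
    case (Suc n)
    have "partial e (\<lambda>z. f z * g z) = (\<lambda>z. f z * partial e g z + partial e f z * g z)" for e
      using Suc.prems by (auto simp: partial_mult smooth_differentiable)
    moreover have "(\<lambda>z. f z * g z) differentiable (at z)" for z
      using Suc.prems by (intro differentiable_mult smooth_differentiable)
    ultimately show ?case
      using Suc.prems by (auto intro!: C_k_add Suc.IH smooth_partial)
  qed
qed

lemma partial_shift:
  assumes "\<And>z. f differentiable (at z)"
  shows "partial e (\<lambda>t. f (t - z)) = (\<lambda>t. partial e f (t - z))"
proof
  fix t
  have "((\<lambda>t. f (t - z)) has_derivative (\<lambda>h. frechet_derivative f (at (t - z)) h)) (at t)"
    by (rule has_derivative_compose[of "\<lambda>t. t - z" "\<lambda>h. h" t UNIV f])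
       (auto intro!: derivative_eq_intros has_derivative_frechet assms)
  then show "partial e (\<lambda>t. f (t - z)) t = partial e f (t - z)"
    by (simp add: partial_eqI partial_def[of _ f])
qed

lemma C_k_shift: "C_k n f \<Longrightarrow> C_k n (\<lambda>t. f (t - z))"
proof (induction n arbitrary: f)
  case 0
  then show ?case by (auto intro!: continuous_on_compose2[of UNIV f] continuous_intros)
next
  case (Suc n)
  have "(\<lambda>t. f (t - z)) differentiable (at t)" for t
    using Suc.prems by (intro differentiable_compose[of f "\<lambda>t. t - z"]) auto
  then show ?case using Suc by (simp add: partial_shift)
qed

section \<open>Test functions\<close>

lemma Cc_infinityD:
  assumes "f \<in> Cc_infinity"
  shows "smooth f" "\<exists>R. \<forall>t. cmod t > R \<longrightarrow> f t = 0"
proof -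
  show "smooth f" using assms by (simp add: Cc_infinity_def)
  have "bounded (closure (support_on UNIV f))"
    using assms by (auto simp: Cc_infinity_def compact_imp_bounded)
  then obtain R where "\<And>t. t \<in> support_on UNIV f \<Longrightarrow> cmod t \<le> R"
    by (meson bounded_iff closure_subset subsetD)
  then show "\<exists>R. \<forall>t. cmod t > R \<longrightarrow> f t = 0"
    by (intro exI[of _ R]) (force simp: support_on_def)
qed

lemma Cc_infinityI:
  assumes "smooth f" "\<And>t. cmod t > R \<Longrightarrow> f t = 0"
  shows "f \<in> Cc_infinity"
proof -
  have "closure (support_on UNIV f) \<subseteq> cball 0 R"
    using assms(2) by (intro closure_minimal) (auto simp: support_on_def, meson not_le)
  then have "compact (closure (support_on UNIV f))"
    by (meson bounded_cball bounded_subset closed_closure compact_eq_bounded_closed)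
  with assms(1) show ?thesis by (simp add: Cc_infinity_def)
qed

lemma Cc_infinity_cc_kernel: "f \<in> Cc_infinity \<Longrightarrow> cc_kernel f"
  unfolding cc_kernel_def using Cc_infinityD smooth_continuous by blast

lemma Cc_infinity_mult:
  assumes "smooth m" "f \<in> Cc_infinity" shows "(\<lambda>z. m z * f z) \<in> Cc_infinity"
proof -
  from Cc_infinityD(2)[OF assms(2)] obtain R where "\<And>t. cmod t > R \<Longrightarrow> f t = 0" by blast
  then show ?thesis
    using assms Cc_infinityD(1)[OF assms(2)] by (intro Cc_infinityI[of _ R] smooth_mult) auto
qed

lemma Cc_infinity_shift:
  assumes "f \<in> Cc_infinity" shows "(\<lambda>t. f (t - z)) \<in> Cc_infinity"
proof -
  from Cc_infinityD(2)[OF assms] obtain R where R: "\<And>t. cmod t > R \<Longrightarrow> f t = 0" by blast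
  have "f (t - z) = 0" if "cmod t > R + cmod z" for t
    using that norm_triangle_ineq2[of t z] by (intro R) auto
  then show ?thesis
    using Cc_infinityD(1)[OF assms] by (intro Cc_infinityI[of _ "R + cmod z"]) (auto intro: C_k_shift)
qed

lemma partial_eq_0_outside:
  assumes "\<And>t. cmod t > R \<Longrightarrow> f t = 0" "cmod z > R"
  shows "partial e f z = 0"
proof -
  have "((\<lambda>_. 0) has_derivative (\<lambda>_. 0)) (at z)" by simp
  moreover have "open (- cball (0::complex) R)" by (intro open_Compl closed_cball)
  ultimately have "(f has_derivative (\<lambda>_. 0)) (at z)"
    by (rule has_derivative_transform_within_open) (use assms in auto)
  then show ?thesis by (rule partial_eqI)
qed

lemma Cc_infinity_partial:
  assumes "f \<in> Cc_infinity"
  shows "partial 1 f \<in> Cc_infinity" "partial \<i> f \<in> Cc_infinity"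
proof -
  from Cc_infinityD(2)[OF assms] obtain R where R: "\<And>t. cmod t > R \<Longrightarrow> f t = 0" by blast
  show "partial 1 f \<in> Cc_infinity" "partial \<i> f \<in> Cc_infinity"
    using Cc_infinityD(1)[OF assms] partial_eq_0_outside[of R f, OF R]
    by (auto intro!: Cc_infinityI[of _ R] smooth_partial)
qed

lemma Cc_infinity_Lipschitz:
  assumes f: "f \<in> Cc_infinity"
  shows "\<exists>L\<ge>0. \<forall>s t. cmod (f s - f t) \<le> L * cmod (s - t)"
proof -
  obtain R1 B1 where 1: "0 \<le> B1" "\<And>t. cmod (partial 1 f t) \<le> B1 * indicator (cball 0 R1) t"
    using cc_kernelD(3)[OF Cc_infinity_cc_kernel[OF Cc_infinity_partial(1)[OF f]]] by blast
  obtain R2 B2 where 2: "0 \<le> B2" "\<And>t. cmod (partial \<i> f t) \<le> B2 * indicator (cball 0 R2) t"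
    using cc_kernelD(3)[OF Cc_infinity_cc_kernel[OF Cc_infinity_partial(2)[OF f]]] by blast
  have d: "f differentiable (at t)" for t using Cc_infinityD(1)[OF f] by (rule smooth_differentiable)
  have "cmod (f s - f t) \<le> (B1 + B2) * cmod (s - t)" for s t
  proof (rule differentiable_bound[of UNIV f "\<lambda>t. frechet_derivative f (at t)"])
    fix z :: complex
    show "(f has_derivative frechet_derivative f (at z)) (at z)"
      by (rule has_derivative_frechet[OF d])
    interpret bounded_linear "frechet_derivative f (at z)"
      using has_derivative_frechet[OF d] by (rule has_derivative_bounded_linear)
    have b: "cmod (partial 1 f z) \<le> B1" "cmod (partial \<i> f z) \<le> B2"
      using 1(1) 1(2)[of z] 2(1) 2(2)[of z] by (auto split: split_indicator_asm)
    show "onorm (frechet_derivative f (at z)) \<le> B1 + B2"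
    proof (rule onorm_le)
      fix v :: complex
      have "frechet_derivative f (at z) v = frechet_derivative f (at z) (Re v *\<^sub>R 1 + Im v *\<^sub>R \<i>)"
        by (simp add: scaleR_conv_of_real complex_eq[symmetric] mult.commute)
      also have "\<dots> = Re v *\<^sub>R partial 1 f z + Im v *\<^sub>R partial \<i> f z"
        unfolding partial_def by (simp only: add scaleR)
      also have "cmod \<dots> \<le> \<bar>Re v\<bar> * cmod (partial 1 f z) + \<bar>Im v\<bar> * cmod (partial \<i> f z)"
        by (metis norm_scaleR norm_triangle_ineq)
      also have "\<dots> \<le> cmod v * B1 + cmod v * B2"
        using b by (intro add_mono mult_mono abs_Re_le_cmod abs_Im_le_cmod) auto
      finally show "cmod (frechet_derivative f (at z) v) \<le> (B1 + B2) * cmod v"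
        by (simp add: algebra_simps)
    qed
  qed auto
  then show ?thesis using 1(1) 2(1) by (intro exI[of _ "B1 + B2"]) auto
qed

section \<open>Flat functions\<close>

text \<open>The functions \<open>x\<^sup>-\<^sup>n exp (-1/x)\<close>, extended by 0. The derivative of each one is a linear combination of two others, so
the family is closed under differentiation and all its members are smooth.\<close>

definition flat :: "nat \<Rightarrow> real \<Rightarrow> real" where
  "flat n x = (if x \<le> 0 then 0 else exp (- 1 / x) / x ^ n)"

lemma flat_tendsto_0: "(flat n \<longlongrightarrow> 0) (at 0)"
proof (subst filterlim_at_split, intro conjI)
  show "(flat n \<longlongrightarrow> 0) (at_left 0)"
    by (rule tendsto_eventually) (auto simp: flat_def eventually_at_filter)
  have "((\<lambda>y. y ^ n / exp y) \<longlongrightarrow> 0) (at_top :: real filter)"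
    by (rule tendsto_power_div_exp_0)
  then have "((\<lambda>x. inverse x ^ n / exp (inverse x)) \<longlongrightarrow> 0) (at_right (0::real))"
    by (rule filterlim_compose[OF _ filterlim_inverse_at_top_right])
  then show "(flat n \<longlongrightarrow> 0) (at_right 0)"
    by (rule Lim_transform_eventually)
       (auto simp: flat_def eventually_at_filter exp_minus field_simps)
qed

lemma flat_deriv:
  "(flat n has_real_derivative (flat (n + 2) x - real n * flat (n + 1) x)) (at x)"
proof (cases x "0::real" rule: linorder_cases)
  case less
  have "((\<lambda>_. 0) has_real_derivative 0) (at x)" by simp
  then have "(flat n has_real_derivative 0) (at x)"
    by (rule has_field_derivative_transform_within_open[of _ _ _ "{..<0}"])
       (use less in \<open>auto simp: flat_def\<close>)
  then show ?thesis using less by (simp add: flat_def)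
next
  case greater
  have pow: "m = 0" if "y ^ m \<noteq> y * y ^ (m - Suc 0)" for y :: real and m
    using that by (cases m) auto
  have "((\<lambda>x. exp (- inverse x) * inverse x ^ n) has_real_derivative
      exp (- inverse x) * inverse x ^ (n + 2) - real n * (exp (- inverse x) * inverse x ^ (n + 1))) (at x)"
    using greater
    by (cases n) (auto intro!: derivative_eq_intros simp: algebra_simps dest: pow)
  then have "((\<lambda>x. exp (- inverse x) * inverse x ^ n) has_real_derivative
      flat (n + 2) x - real n * flat (n + 1) x) (at x)"
    using greater by (simp add: flat_def field_simps)
  then show ?thesis
    by (rule has_field_derivative_transform_within_open[of _ _ _ "{0<..}"])
       (use greater in \<open>auto simp: flat_def field_simps\<close>)
next
  case equal
  have "((\<lambda>h. (flat n (0 + h) - flat n 0) / h) \<longlongrightarrow> 0) (at 0)"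
    by (rule Lim_transform_eventually[OF flat_tendsto_0[of "n + 1"]])
       (auto simp: flat_def eventually_at_filter field_simps)
  then show ?thesis using equal by (simp add: DERIV_def flat_def)
qed

lemma C_k_cmult: "C_k n f \<Longrightarrow> C_k n (\<lambda>z. c * f z)"
proof (induction n arbitrary: f)
  case (Suc n)
  have "partial e (\<lambda>z. c * f z) = (\<lambda>z. c * partial e f z)" for e
    using Suc.prems unfolding partial_def[of _ f]
    by (intro ext partial_eqI) (auto intro!: has_derivative_mult_right has_derivative_frechet)
  then show ?case using Suc by simp
qed (simp add: continuous_on_mult_left)

text \<open>Composition with affine functions of the plane. The derivatives are again linear combinations of functions of this
form, so the induction keeps \<open>l\<close> and \<open>b\<close> fixed and varies only the index \<open>m\<close>.\<close>

lemma smooth_flat: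
  assumes "bounded_linear l"
  shows "smooth (\<lambda>t. of_real (flat m (l t + b)))"
proof
  fix n
  show "C_k n (\<lambda>t. of_real (flat m (l t + b)))"
  proof (induction n arbitrary: m)
    case 0
    have "continuous_on UNIV (flat m)"
      by (rule DERIV_continuous_on[OF has_field_derivative_at_within[OF flat_deriv]])
    moreover have "continuous_on UNIV (\<lambda>t. l t + b)"
      using linear_continuous_on[OF assms] by (intro continuous_on_add continuous_on_const)
    ultimately have "continuous_on UNIV (\<lambda>t. flat m (l t + b))"
      by (rule continuous_on_compose2) simp
    then show ?case by (simp add: continuous_on_of_real)
  next
    case (Suc n)
    have d: "((\<lambda>t. of_real (flat m (l t + b)) :: complex) has_derivative
      (\<lambda>v. of_real ((flat (m + 2) (l t + b) - real m * flat (m + 1) (l t + b)) * l v))) (at t)" for t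
    proof -
      have "((\<lambda>t. l t + b) has_derivative l) (at t)"
        using bounded_linear_imp_has_derivative[OF assms] by (auto intro!: derivative_eq_intros)
      from has_derivative_compose[OF this flat_deriv[unfolded has_field_derivative_def]]
      show ?thesis by (intro has_derivative_of_real) simp
    qed
    have "partial e (\<lambda>t. of_real (flat m (l t + b))) = 
      (\<lambda>t. of_real (l e) * of_real (flat (m + 2) (l t + b))
         + (- of_real (l e) * of_real m) * of_real (flat (m + 1) (l t + b)))" for e
      by (rule ext, rule trans[OF partial_eqI[OF d]]) (simp add: algebra_simps)
    moreover have "(\<lambda>t. of_real (flat m (l t + b)) :: complex) differentiable (at t)" for t
      using d by (auto simp: differentiable_def)
    ultimately show ?case
      by (simp only: C_k.simps) (intro conjI allI TrueI C_k_add C_k_cmult Suc.IH)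
  qed
qed

section \<open>Product kernels\<close>

definition tensor :: "(real \<Rightarrow> real) \<Rightarrow> (real \<Rightarrow> real) \<Rightarrow> complex \<Rightarrow> complex" where
  "tensor p q t = of_real (p (Re t) * q (Im t))"

lemma tensor_has_derivative:
  assumes p: "\<And>x. (p has_real_derivative p' x) (at x)" and q: "\<And>x. (q has_real_derivative q' x) (at x)"
  shows "(tensor p q has_derivative
    (\<lambda>v. of_real (p (Re t) * (q' (Im t) * Im v) + (p' (Re t) * Re v) * q (Im t)))) (at t)"
proof -
  have "((\<lambda>t. p (Re t)) has_derivative (\<lambda>v. p' (Re t) * Re v)) (at t)"
    by (rule has_derivative_compose[OF has_derivative_Re[OF has_derivative_ident]
          p[of "Re t", unfolded has_field_derivative_def]])
  moreover have "((\<lambda>t. q (Im t)) has_derivative (\<lambda>v. q' (Im t) * Im v)) (at t)"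
    by (rule has_derivative_compose[OF has_derivative_Im[OF has_derivative_ident]
          q[of "Im t", unfolded has_field_derivative_def]])
  ultimately show ?thesis
    unfolding tensor_def by (intro has_derivative_of_real has_derivative_mult)
qed

lemma partial_tensor:
  assumes "\<And>x. (p has_real_derivative p' x) (at x)" "\<And>x. (q has_real_derivative q' x) (at x)"
  shows "partial 1 (tensor p q) = tensor p' q" "partial \<i> (tensor p q) = tensor p q'"
  by (rule ext, subst partial_eqI[OF tensor_has_derivative[OF assms]], simp add: tensor_def)+

lemma integral_tensor_mult:
  assumes "integrable lborel (\<lambda>x. of_real (p x) :: complex)" "integrable lborel (\<lambda>x. of_real (q x) :: complex)"
  shows "(\<integral>z. of_real (p (Re z) * q (Im z)) \<partial>lborel) = (of_real ((\<integral>x. p x \<partial>lborel) * (\<integral>x. q x \<partial>lborel)) :: complex)"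
  using integral_complex_product[OF assms] by simp

lemma integrable_compact_support:
  fixes p :: "real \<Rightarrow> real"
  assumes "continuous_on UNIV p" "\<And>x. x \<notin> {a..b} \<Longrightarrow> p x = 0"
  shows "integrable lborel p"
proof -
  have "integrable lborel (\<lambda>x. indicator {a..b} x *\<^sub>R p x)"
    by (rule borel_integrable_compact) (auto intro: continuous_on_subset[OF assms(1)])
  moreover have "(\<lambda>x. indicator {a..b} x *\<^sub>R p x) = p"
  proof
    fix x show "indicator {a..b} x *\<^sub>R p x = p x"
      using assms(2)[of x] by (cases "x \<in> {a..b}") simp_all
  qed
  ultimately show ?thesis by simp
qed

lemma integrable_indicator_continuous:
  fixes p :: "real \<Rightarrow> real"
  assumes "continuous_on UNIV p"
  shows "integrable lborel (\<lambda>x. indicator {a..b} x * p x)"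
  using borel_integrable_compact[of "{a..b}" p] continuous_on_subset[OF assms] by simp


text \<open>The conditions on the bump are scaled so that \<open>r\<close> may approximate the indicator of \<open>[0, h]\<close> divided by \<open>h\<close>. The
total variation is at most \<open>2/h\<close>, the value for a function that rises once to \<open>1/h\<close> and falls once. All estimates
derived from these conditions are uniform in \<open>r\<close> and in \<open>h\<close>.\<close>

locale smooth_window =
  fixes r r' r'' :: "real \<Rightarrow> real" and h :: real
  assumes h: "0 < h" "h \<le> 1"
    and deriv: "\<And>x. (r has_real_derivative r' x) (at x)"
    and deriv2: "\<And>x. (r' has_real_derivative r'' x) (at x)"
    and smooth_tensor: "smooth (tensor r r)"
    and nonneg: "\<And>x. 0 \<le> r x"
    and le: "\<And>x. r x \<le> indicator {0..h} x / h"
    and variation: "(\<integral>\<^sup>+x. ennreal \<bar>r' x\<bar> \<partial>lborel) \<le> ennreal (2 / h)"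
begin

lemma r_eq_0: "x \<notin> {0..h} \<Longrightarrow> r x = 0"
  using nonneg[of x] le[of x] by simp

lemma r'_eq_0: "x \<notin> {0..h} \<Longrightarrow> r' x = 0"
proof -
  assume x: "x \<notin> {0..h}"
  have "((\<lambda>_. 0) has_real_derivative 0) (at x)" by simp
  then have "(r has_real_derivative 0) (at x)"
    by (rule has_field_derivative_transform_within_open[of _ _ _ "- {0..h}"])
       (use x r_eq_0 in \<open>auto intro!: open_Compl\<close>)
  with deriv[of x] show ?thesis by (rule DERIV_unique)
qed

lemma cont_r: "continuous_on A r" and cont_r': "continuous_on A r'"
  using DERIV_continuous_on[OF has_field_derivative_at_within[OF deriv]]
    DERIV_continuous_on[OF has_field_derivative_at_within[OF deriv2]] by blast+

lemma cont_reflect: "continuous_on A (\<lambda>x. r (a - x))" "continuous_on A (\<lambda>x. r' (a - x))"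
  by (rule continuous_on_compose2[OF cont_r[of UNIV]] continuous_on_compose2[OF cont_r'[of UNIV]];
      simp add: continuous_on_diff)+

lemma isCont_r: "isCont r x" and isCont_r': "isCont r' x"
  using DERIV_isCont[OF deriv] DERIV_isCont[OF deriv2] by auto

lemma r_measurable [measurable]: "r \<in> borel_measurable borel" "r' \<in> borel_measurable borel"
  by (intro borel_measurable_continuous_onI cont_r cont_r')+

lemma partials:
  "partial 1 (tensor r r) = tensor r' r" "partial \<i> (tensor r r) = tensor r r'"
  "partial \<i> (tensor r' r) = tensor r' r'" "partial 1 (tensor r r') = tensor r' r'"
  by (rule partial_tensor deriv deriv2)+

lemma tensor_Cc:
  "tensor r r \<in> Cc_infinity" "tensor r' r \<in> Cc_infinity" "tensor r r' \<in> Cc_infinity" "tensor r' r' \<in> Cc_infinity"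
proof -
  have "tensor r r t = 0" if t: "cmod t > 2" for t
  proof -
    have "2 < \<bar>Re t\<bar> + \<bar>Im t\<bar>" using cmod_le[of t] t by linarith
    then have "Re t \<notin> {0..h} \<or> Im t \<notin> {0..h}" using h by auto
    then show ?thesis using r_eq_0 by (auto simp: tensor_def)
  qed
  then show 1: "tensor r r \<in> Cc_infinity" by (intro Cc_infinityI[OF smooth_tensor])
  show 2: "tensor r' r \<in> Cc_infinity" "tensor r r' \<in> Cc_infinity"
    using Cc_infinity_partial[OF 1] by (simp_all add: partials)
  show "tensor r' r' \<in> Cc_infinity"
    using Cc_infinity_partial(2)[OF 2(1)] by (simp add: partials)
qed

lemmas tensor_cc = tensor_Cc[THEN Cc_infinity_cc_kernel]

lemma tensor_measurable [measurable]:
  "tensor r r \<in> borel_measurable borel" "tensor r' r \<in> borel_measurable borel"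
  "tensor r r' \<in> borel_measurable borel" "tensor r' r' \<in> borel_measurable borel"
  by (intro cc_kernelD(1) tensor_cc)+

lemma nn_integral_r: "(\<integral>\<^sup>+x. ennreal (r x) \<partial>lborel) \<le> 1"
proof -
  have "(\<integral>\<^sup>+x. ennreal (r x) \<partial>lborel) \<le> (\<integral>\<^sup>+x. ennreal (1 / h) * indicator {0..h} x \<partial>lborel)"
  proof (rule nn_integral_mono)
    fix x show "ennreal (r x) \<le> ennreal (1 / h) * indicator {0..h} x"
      using ennreal_leI[OF le[of x]] by (cases "x \<in> {0..h}") simp_all
  qed
  also have "\<dots> = 1"
    using h by (simp add: nn_integral_cmult ennreal_mult[symmetric] del: ennreal_1 flip: ennreal_1)
  finally show ?thesis .
qed

lemma nn_integral_tensor: "(\<integral>\<^sup>+t. ennreal (cmod (tensor r r t)) \<partial>lborel) \<le> 1"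
proof -
  have "(\<integral>\<^sup>+t. ennreal (cmod (tensor r r t)) \<partial>lborel) = (\<integral>\<^sup>+t. ennreal (r (Re t)) * ennreal (r (Im t)) \<partial>lborel)"
    using nonneg by (intro nn_integral_cong) (simp add: tensor_def norm_mult ennreal_mult)
  also have "\<dots> = (\<integral>\<^sup>+x. ennreal (r x) \<partial>lborel) * (\<integral>\<^sup>+x. ennreal (r x) \<partial>lborel)"
    by (rule nn_integral_complex_product) measurable
  also have "\<dots> \<le> 1 * 1" using nn_integral_r by (intro mult_mono) auto
  finally show ?thesis by simp
qed

text \<open>The kernel \<open>\<rho>\<^sub>x\<close> has \<open>L\<^sup>1\<close> norm of order \<open>1/h\<close>, but \<open>\<bar>t\<bar> \<le> 2 h\<close> on its support, so that the product is bounded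
independently of \<open>h\<close>. This is what makes commutators with Lipschitz functions bounded.\<close>

lemma nn_integral_tensor'_norm:
  "(\<integral>\<^sup>+t. ennreal (cmod (tensor r' r t) * cmod t) \<partial>lborel) \<le> ennreal 4"
proof -
  have "(\<integral>\<^sup>+t. ennreal (cmod (tensor r' r t) * cmod t) \<partial>lborel)
      \<le> (\<integral>\<^sup>+t. ennreal (2 * h) * (ennreal \<bar>r' (Re t)\<bar> * ennreal (r (Im t))) \<partial>lborel)"
  proof (rule nn_integral_mono)
    fix t :: complex
    show "ennreal (cmod (tensor r' r t) * cmod t) \<le> ennreal (2 * h) * (ennreal \<bar>r' (Re t)\<bar> * ennreal (r (Im t)))"
    proof (cases "Re t \<in> {0..h} \<and> Im t \<in> {0..h}")
      case True
      then have "cmod t \<le> 2 * h" using cmod_le[of t] by auto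
      then have "cmod (tensor r' r t) * cmod t \<le> 2 * h * (\<bar>r' (Re t)\<bar> * r (Im t))"
        using nonneg[of "Im t"] by (simp add: tensor_def norm_mult mult.commute mult_right_mono)
      then show ?thesis
        using h nonneg[of "Im t"] by (simp add: ennreal_mult[symmetric] ennreal_leI)
    next
      case False
      then show ?thesis using r_eq_0 r'_eq_0 by (auto simp: tensor_def)
    qed
  qed
  also have "\<dots> = ennreal (2 * h) * ((\<integral>\<^sup>+x. ennreal \<bar>r' x\<bar> \<partial>lborel) * (\<integral>\<^sup>+x. ennreal (r x) \<partial>lborel))"
    using nn_integral_complex_product[of "\<lambda>x. ennreal \<bar>r' x\<bar>" "\<lambda>x. ennreal (r x)"]
    by (subst nn_integral_cmult) simp_all
  also have "\<dots> \<le> ennreal (2 * h) * (ennreal (2 / h) * 1)"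
    using nn_integral_r variation by (intro mult_left_mono mult_mono) auto
  also have "\<dots> = ennreal 4" using h by (simp add: ennreal_mult[symmetric])
  finally show ?thesis .
qed

lemma integrable_r_r':
  "integrable lborel (\<lambda>x. r' (a - x) * r (b - x))" "integrable lborel (\<lambda>x. r (a - x) * r' (b - x))"
proof -
  show "integrable lborel (\<lambda>x. r' (a - x) * r (b - x))" "integrable lborel (\<lambda>x. r (a - x) * r' (b - x))"
    by (rule integrable_compact_support[of _ "a - h" a];
        auto intro!: continuous_on_mult cont_reflect simp: r_eq_0 r'_eq_0)+
qed

text \<open>Integration by parts, the product having compact support.\<close>

lemma integral_r_r': "(\<integral>x. r' (a - x) * r (b - x) \<partial>lborel) = - (\<integral>x. r (a - x) * r' (b - x) \<partial>lborel)"
proof -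
  have "(\<integral>x. (r' (a - x) * r (b - x) + r (a - x) * r' (b - x)) * indicator {a - 2 .. a + 1} x \<partial>lborel)
     = - (r (a - (a + 1)) * r (b - (a + 1))) - - (r (a - (a - 2)) * r (b - (a - 2)))"
    by (rule integral_FTC_Icc_real)
       (auto intro!: derivative_eq_intros DERIV_chain2[OF deriv] continuous_intros
          isCont_o2[OF _ isCont_r] isCont_o2[OF _ isCont_r'])
  also have "\<dots> = 0" using h by (simp add: r_eq_0)
  also have "(\<lambda>x. (r' (a - x) * r (b - x) + r (a - x) * r' (b - x)) * indicator {a - 2 .. a + 1} x)
      = (\<lambda>x. r' (a - x) * r (b - x) + r (a - x) * r' (b - x))"
  proof
    fix x
    show "(r' (a - x) * r (b - x) + r (a - x) * r' (b - x)) * indicator {a - 2 .. a + 1} x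
      = r' (a - x) * r (b - x) + r (a - x) * r' (b - x)"
      using h by (cases "x \<in> {a - 2 .. a + 1}") (auto simp: r_eq_0 r'_eq_0)
  qed
  finally show ?thesis
    using integrable_r_r' by simp
qed

text \<open>Both sides split into a product of one-dimensional integrals. Passing from one side to the other moves the
derivative once in the factor for the real part and once in the factor for the imaginary part, and the two signs cancel.\<close>

lemma tensor_kernel_symmetric:
  "(\<integral>z. tensor r' r (s - z) * tensor r r' (t - z) \<partial>lborel)
    = (\<integral>z. tensor r r' (s - z) * tensor r' r (t - z) \<partial>lborel)"
proof -
  have "(\<integral>z. tensor r' r (s - z) * tensor r r' (t - z) \<partial>lborel)
    = (\<integral>z. of_real ((r' (Re s - Re z) * r (Re t - Re z)) * (r (Im s - Im z) * r' (Im t - Im z))) \<partial>lborel)"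
    by (simp add: tensor_def ac_simps)
  also have "\<dots> = of_real ((\<integral>x. r' (Re s - x) * r (Re t - x) \<partial>lborel) * (\<integral>x. r (Im s - x) * r' (Im t - x) \<partial>lborel))"
    by (rule integral_tensor_mult) (intro integrable_of_real integrable_r_r')+
  also have "\<dots> = of_real ((\<integral>x. r (Re s - x) * r' (Re t - x) \<partial>lborel) * (\<integral>x. r' (Im s - x) * r (Im t - x) \<partial>lborel))"
    by (simp add: integral_r_r')
  also have "\<dots> = (\<integral>z. of_real ((r (Re s - Re z) * r' (Re t - Re z)) * (r' (Im s - Im z) * r (Im t - Im z))) \<partial>lborel)"
    by (rule integral_tensor_mult[symmetric]) (intro integrable_of_real integrable_r_r')+
  also have "\<dots> = (\<integral>z. tensor r r' (s - z) * tensor r' r (t - z) \<partial>lborel)"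
    by (simp add: tensor_def ac_simps)
  finally show ?thesis .
qed

text \<open>With \<open>v = \<rho> * f\<close>, the imaginary part of \<open>v\<^sub>x\<close> times the conjugate of \<open>v\<^sub>y\<close> is, up to sign, the Jacobian
determinant of \<open>v\<close>. It integrates to zero: by the symmetry of the kernels the integral of the product equals its own
complex conjugate.\<close>

lemma energy_identity:
  assumes f: "square_integrable f"
  shows "Im (\<integral>z. corr (tensor r' r) f z * cnj (corr (tensor r r') f z) \<partial>lborel) = 0"
proof -
  have f': "square_integrable (\<lambda>z. cnj (f z))"
    using f borel_measurable_continuous_on[of cnj f lborel]
    by (simp add: square_integrable_def sqnorm_def continuous_on_cnj)
  have cnj: "corr (tensor p q) (\<lambda>z. cnj (f z)) z = cnj (corr (tensor p q) f z)" for p q z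
    unfolding corr_def by (subst Bochner_Integration.integral_cnj[symmetric]) (simp add: tensor_def)
  have "(\<integral>z. corr (tensor r' r) f z * corr (tensor r r') (\<lambda>z. cnj (f z)) z \<partial>lborel)
     = (\<integral>z. corr (tensor r r') f z * corr (tensor r' r) (\<lambda>z. cnj (f z)) z \<partial>lborel)"
    by (simp add: integral_corr_mult_corr tensor_cc f f' tensor_kernel_symmetric)
  also have "\<dots> = (\<integral>z. cnj (corr (tensor r' r) f z * cnj (corr (tensor r r') f z)) \<partial>lborel)"
    by (simp add: cnj mult.commute)
  finally have "(\<integral>z. corr (tensor r' r) f z * cnj (corr (tensor r r') f z) \<partial>lborel)
     = cnj (\<integral>z. corr (tensor r' r) f z * cnj (corr (tensor r r') f z) \<partial>lborel)"
    by (simp add: cnj flip: Bochner_Integration.integral_cnj)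
  then show ?thesis by (metis complex_cnj_cancel_iff Reals_cnj_iff complex_is_Real_iff)
qed

lemma integral_r': "(\<integral>x. indicator {0..a} x * r' (y - x) \<partial>lborel) = r y - r (y - a)" if "0 \<le> a"
proof -
  have "(\<integral>x. r' (y - x) * indicator {0..a} x \<partial>lborel) = - r (y - a) - - r (y - 0)"
    by (rule integral_FTC_Icc_real)
       (use that in \<open>auto intro!: derivative_eq_intros DERIV_chain2[OF deriv] continuous_intros
          isCont_o2[OF _ isCont_r] isCont_o2[OF _ isCont_r']\<close>)
  then show ?thesis by (simp add: mult.commute)
qed

lemma integrable_pieces:
  "integrable lborel (\<lambda>x. indicator {a..b} x * r (y - x))"
  "integrable lborel (\<lambda>x. indicator {a..b} x * r' (y - x))"
  "integrable lborel (\<lambda>x. indicator {a..b} x * ((1 - x) * r' (y - x)))"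
proof -
  show "integrable lborel (\<lambda>x. indicator {a..b} x * r (y - x))"
    "integrable lborel (\<lambda>x. indicator {a..b} x * r' (y - x))"
    "integrable lborel (\<lambda>x. indicator {a..b} x * ((1 - x) * r' (y - x)))"
    by (intro integrable_indicator_continuous continuous_on_mult continuous_on_diff
        continuous_on_const continuous_on_id cont_reflect)+
qed

text \<open>The integrand is the derivative of \<open>- (1 - x) r (y - x)\<close>, whose boundary term at \<open>x = 1\<close> vanishes.\<close>

lemma r_as_average:
  "r y = (\<integral>x. indicator {0..1} x * r (y - x) \<partial>lborel) + (\<integral>x. indicator {0..1} x * ((1 - x) * r' (y - x)) \<partial>lborel)"
proof -
  have "(\<integral>x. (r (y - x) + (1 - x) * r' (y - x)) * indicator {0..1} x \<partial>lborel) = - (1 - 1) * r (y - 1) - - (1 - 0) * r (y - 0)"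
    by (rule integral_FTC_Icc_real)
       (auto intro!: derivative_eq_intros DERIV_chain2[OF deriv] continuous_intros
          isCont_o2[OF _ isCont_r] isCont_o2[OF _ isCont_r'] simp: algebra_simps)
  also have "(\<integral>x. (r (y - x) + (1 - x) * r' (y - x)) * indicator {0..1} x \<partial>lborel)
    = (\<integral>x. indicator {0..1} x * r (y - x) + indicator {0..1} x * ((1 - x) * r' (y - x)) \<partial>lborel)"
    by (simp add: algebra_simps)
  finally show ?thesis using integrable_pieces by simp
qed

end

section \<open>Increments of regularised functions\<close>

text \<open>The step common to both coordinate directions: an increment of the kernel that is an average of translates of \<open>k1\<close> and
\<open>k2\<close> over \<open>S\<close> gives an increment of the regularised function of the order of the square root of the area of \<open>S\<close>.\<close>

lemma increment_bound:
  fixes k k1 k2 c1 c2 :: "complex \<Rightarrow> complex"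
  assumes g: "locally_integrable g" and k: "cc_kernel k" "cc_kernel k1" "cc_kernel k2"
    and c[measurable]: "c1 \<in> borel_measurable borel" "c2 \<in> borel_measurable borel"
    and cS: "\<And>\<zeta>. cmod (c1 \<zeta>) \<le> indicator S \<zeta>" "\<And>\<zeta>. cmod (c2 \<zeta>) \<le> indicator S \<zeta>"
    and S: "bounded S" "S \<in> sets borel" "emeasure lborel S = ennreal a" "0 \<le> a"
    and repr: "\<And>\<tau>. k (\<tau> - d) - k \<tau>
      = (\<integral>\<zeta>. c1 \<zeta> * k1 (\<tau> - \<zeta>) \<partial>lborel) + (\<integral>\<zeta>. c2 \<zeta> * k2 (\<tau> - \<zeta>) \<partial>lborel)"
    and b: "sqnorm (corr k1 g) \<le> ennreal (b1\<^sup>2)" "sqnorm (corr k2 g) \<le> ennreal (b2\<^sup>2)" "0 \<le> b1" "0 \<le> b2"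
  shows "cmod (corr k g (z + d) - corr k g z) \<le> (b1 + b2) * sqrt a"
proof -
  let ?I1 = "\<lambda>t. (\<integral>\<zeta>. c1 \<zeta> * k1 (t - (z + \<zeta>)) \<partial>lborel) * g t"
  let ?I2 = "\<lambda>t. (\<integral>\<zeta>. c2 \<zeta> * k2 (t - (z + \<zeta>)) \<partial>lborel) * g t"
  note w1 = weighted_average_bound[OF c(1) cS(1) S(1,2) k(2) g, of z]
  note w2 = weighted_average_bound[OF c(2) cS(2) S(1,2) k(3) g, of z]
  have "corr k g (z + d) - corr k g z = (\<integral>t. k (t - (z + d)) * g t - k (t - z) * g t \<partial>lborel)"
    unfolding corr_def
    by (rule Bochner_Integration.integral_diff[symmetric]) (rule integrable_corr[OF k(1) g])+
  also have "\<dots> = (\<integral>t. ?I1 t + ?I2 t \<partial>lborel)"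
    using repr[of "t - z" for t] by (simp add: diff_diff_eq flip: left_diff_distrib distrib_right)
  also have "\<dots> = (\<integral>t. ?I1 t \<partial>lborel) + (\<integral>t. ?I2 t \<partial>lborel)"
    by (rule Bochner_Integration.integral_add[OF w1(1) w2(1)])
  finally have eq: "corr k g (z + d) - corr k g z = (\<integral>t. ?I1 t \<partial>lborel) + (\<integral>t. ?I2 t \<partial>lborel)" .
  have le: "X \<le> \<beta> * sqrt a"
    if "(ennreal X)\<^sup>2 \<le> emeasure lborel S * Y" "Y \<le> ennreal (\<beta>\<^sup>2)" "0 \<le> X" "0 \<le> \<beta>" for X Y \<beta>
  proof -
    have "ennreal (X\<^sup>2) \<le> emeasure lborel S * Y" using that by (simp add: ennreal_power)
    also have "\<dots> \<le> ennreal a * ennreal (\<beta>\<^sup>2)" using that S(3) by (auto intro: mult_left_mono)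
    also have "\<dots> = ennreal (a * \<beta>\<^sup>2)" using S(4) by (simp add: ennreal_mult)
    finally have "X\<^sup>2 \<le> a * \<beta>\<^sup>2" using S(4) by (simp add: ennreal_le_iff)
    then have "X \<le> sqrt (a * \<beta>\<^sup>2)" by (rule real_le_rsqrt)
    then show ?thesis using that by (simp add: real_sqrt_mult mult.commute)
  qed
  have "cmod (\<integral>t. ?I1 t \<partial>lborel) \<le> b1 * sqrt a" "cmod (\<integral>t. ?I2 t \<partial>lborel) \<le> b2 * sqrt a"
    using le[OF w1(2) b(1)] le[OF w2(2) b(2)] b by auto
  then show ?thesis
    unfolding eq distrib_right by (rule norm_triangle_mono)
qed

lemma rectangle:
  fixes a b :: real assumes "0 \<le> a" "0 \<le> b"
  shows "bounded (cbox 0 (Complex a b))" "cbox 0 (Complex a b) \<in> sets borel"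
    "emeasure lborel (cbox 0 (Complex a b)) = ennreal (a * b)"
    "indicator (cbox 0 (Complex a b)) \<zeta> = indicator {0..a} (Re \<zeta>) * (indicator {0..b} (Im \<zeta>) :: real)"
proof -
  show "emeasure lborel (cbox 0 (Complex a b)) = ennreal (a * b)"
    using assms by (simp add: emeasure_lborel_cbox_eq Basis_complex_def inner_complex_def)
qed (auto simp: in_cbox_complex_iff indicator_def)


context smooth_window
begin

text \<open>The weights express \<open>\<rho>(\<tau> - a) - \<rho>(\<tau>)\<close> as an integral over the rectangle \<open>[0, a] \<times> [0, 1]\<close>: in the real part the
increment of \<open>r\<close> is the integral of its derivative, and in the imaginary part \<open>r\<close> is written as in
\<open>r_as_average\<close>, the weight \<open>1 - y\<close> accompanying the additional derivative.\<close>

lemma increment_x: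
  assumes g: "locally_integrable g" and a: "0 \<le> a"
    and b: "sqnorm (corr (tensor r' r) g) \<le> ennreal (b1\<^sup>2)" "sqnorm (corr (tensor r' r') g) \<le> ennreal (b2\<^sup>2)" "0 \<le> b1" "0 \<le> b2"
  shows "cmod (corr (tensor r r) g (z + of_real a) - corr (tensor r r) g z) \<le> (b1 + b2) * sqrt a"
proof (rule increment_bound[OF g tensor_cc(1,2,4) _ _ _ _ rectangle(1,2)[OF a, of 1] _ a _ b,
      where ?c1.0 = "\<lambda>\<zeta>. - of_real (indicator {0..a} (Re \<zeta>) * indicator {0..1} (Im \<zeta>))"
        and ?c2.0 = "\<lambda>\<zeta>. - of_real (indicator {0..a} (Re \<zeta>) * (indicator {0..1} (Im \<zeta>) * (1 - Im \<zeta>)))"])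
  show "emeasure lborel (cbox 0 (Complex a 1)) = ennreal a"
    using rectangle(3)[OF a, of 1] by simp
  fix \<tau> :: complex
  let ?I = "\<integral>y. indicator {0..1} y * r (Im \<tau> - y) \<partial>lborel"
  let ?J = "\<integral>y. indicator {0..1} y * ((1 - y) * r' (Im \<tau> - y)) \<partial>lborel"
  have 1: "(\<integral>\<zeta>. - of_real (indicator {0..a} (Re \<zeta>) * indicator {0..1} (Im \<zeta>)) * tensor r' r (\<tau> - \<zeta>) \<partial>lborel)
    = - (\<integral>\<zeta>. of_real ((indicator {0..a} (Re \<zeta>) * r' (Re \<tau> - Re \<zeta>)) * (indicator {0..1} (Im \<zeta>) * r (Im \<tau> - Im \<zeta>))) \<partial>lborel)"
    by (simp add: tensor_def ac_simps)
  have 2: "(\<integral>\<zeta>. - of_real (indicator {0..a} (Re \<zeta>) * (indicator {0..1} (Im \<zeta>) * (1 - Im \<zeta>))) * tensor r' r' (\<tau> - \<zeta>) \<partial>lborel)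
    = - (\<integral>\<zeta>. of_real ((indicator {0..a} (Re \<zeta>) * r' (Re \<tau> - Re \<zeta>)) * (indicator {0..1} (Im \<zeta>) * ((1 - Im \<zeta>) * r' (Im \<tau> - Im \<zeta>)))) \<partial>lborel)"
    by (simp add: tensor_def ac_simps)
  have "tensor r r (\<tau> - of_real a) - tensor r r \<tau> = - of_real ((r (Re \<tau>) - r (Re \<tau> - a)) * (?I + ?J))"
    unfolding r_as_average[symmetric] by (simp add: tensor_def algebra_simps)
  also have "\<dots> = - of_real ((r (Re \<tau>) - r (Re \<tau> - a)) * ?I) + - of_real ((r (Re \<tau>) - r (Re \<tau> - a)) * ?J)"
    by (simp add: algebra_simps)
  finally show "tensor r r (\<tau> - of_real a) - tensor r r \<tau> =
    (\<integral>\<zeta>. - of_real (indicator {0..a} (Re \<zeta>) * indicator {0..1} (Im \<zeta>)) * tensor r' r (\<tau> - \<zeta>) \<partial>lborel)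
    + (\<integral>\<zeta>. - of_real (indicator {0..a} (Re \<zeta>) * (indicator {0..1} (Im \<zeta>) * (1 - Im \<zeta>))) * tensor r' r' (\<tau> - \<zeta>) \<partial>lborel)"
    unfolding 1 2
    by (subst (1 2) integral_tensor_mult) (auto simp only: integral_r'[OF a] intro!: integrable_of_real integrable_pieces)
next
  fix \<zeta> :: complex
  show "cmod (- of_real (indicator {0..a} (Re \<zeta>) * indicator {0..1} (Im \<zeta>))) \<le> indicator (cbox 0 (Complex a 1)) \<zeta>"
    "cmod (- of_real (indicator {0..a} (Re \<zeta>) * (indicator {0..1} (Im \<zeta>) * (1 - Im \<zeta>)))) \<le> indicator (cbox 0 (Complex a 1)) \<zeta>"
    unfolding rectangle(4)[OF a zero_le_one] norm_minus_cancel norm_of_real by (auto simp: abs_mult split: split_indicator)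
qed measurable

lemma increment_y:
  assumes g: "locally_integrable g" and a: "0 \<le> a"
    and b: "sqnorm (corr (tensor r r') g) \<le> ennreal (b1\<^sup>2)" "sqnorm (corr (tensor r' r') g) \<le> ennreal (b2\<^sup>2)" "0 \<le> b1" "0 \<le> b2"
  shows "cmod (corr (tensor r r) g (z + \<i> * of_real a) - corr (tensor r r) g z) \<le> (b1 + b2) * sqrt a"
proof (rule increment_bound[OF g tensor_cc(1,3,4) _ _ _ _ rectangle(1,2)[OF zero_le_one a] _ a _ b,
      where ?c1.0 = "\<lambda>\<zeta>. - of_real (indicator {0..1} (Re \<zeta>) * indicator {0..a} (Im \<zeta>))"
        and ?c2.0 = "\<lambda>\<zeta>. - of_real ((indicator {0..1} (Re \<zeta>) * (1 - Re \<zeta>)) * indicator {0..a} (Im \<zeta>))"])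
  show "emeasure lborel (cbox 0 (Complex 1 a)) = ennreal a"
    using rectangle(3)[OF zero_le_one a] by simp
  fix \<tau> :: complex
  let ?I = "\<integral>y. indicator {0..1} y * r (Re \<tau> - y) \<partial>lborel"
  let ?J = "\<integral>y. indicator {0..1} y * ((1 - y) * r' (Re \<tau> - y)) \<partial>lborel"
  have 1: "(\<integral>\<zeta>. - of_real (indicator {0..1} (Re \<zeta>) * indicator {0..a} (Im \<zeta>)) * tensor r r' (\<tau> - \<zeta>) \<partial>lborel)
    = - (\<integral>\<zeta>. of_real ((indicator {0..1} (Re \<zeta>) * r (Re \<tau> - Re \<zeta>)) * (indicator {0..a} (Im \<zeta>) * r' (Im \<tau> - Im \<zeta>))) \<partial>lborel)"
    by (simp add: tensor_def ac_simps)
  have 2: "(\<integral>\<zeta>. - of_real ((indicator {0..1} (Re \<zeta>) * (1 - Re \<zeta>)) * indicator {0..a} (Im \<zeta>)) * tensor r' r' (\<tau> - \<zeta>) \<partial>lborel)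
    = - (\<integral>\<zeta>. of_real ((indicator {0..1} (Re \<zeta>) * ((1 - Re \<zeta>) * r' (Re \<tau> - Re \<zeta>))) * (indicator {0..a} (Im \<zeta>) * r' (Im \<tau> - Im \<zeta>))) \<partial>lborel)"
    by (simp add: tensor_def ac_simps)
  have "tensor r r (\<tau> - \<i> * of_real a) - tensor r r \<tau> = - of_real ((?I + ?J) * (r (Im \<tau>) - r (Im \<tau> - a)))"
    unfolding r_as_average[symmetric] by (simp add: tensor_def algebra_simps)
  also have "\<dots> = - of_real (?I * (r (Im \<tau>) - r (Im \<tau> - a))) + - of_real (?J * (r (Im \<tau>) - r (Im \<tau> - a)))"
    by (simp add: algebra_simps)
  finally show "tensor r r (\<tau> - \<i> * of_real a) - tensor r r \<tau> =
    (\<integral>\<zeta>. - of_real (indicator {0..1} (Re \<zeta>) * indicator {0..a} (Im \<zeta>)) * tensor r r' (\<tau> - \<zeta>) \<partial>lborel)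
    + (\<integral>\<zeta>. - of_real ((indicator {0..1} (Re \<zeta>) * (1 - Re \<zeta>)) * indicator {0..a} (Im \<zeta>)) * tensor r' r' (\<tau> - \<zeta>) \<partial>lborel)"
    unfolding 1 2
    by (subst (1 2) integral_tensor_mult) (auto simp only: integral_r'[OF a] intro!: integrable_of_real integrable_pieces)
next
  fix \<zeta> :: complex
  show "cmod (- of_real (indicator {0..1} (Re \<zeta>) * indicator {0..a} (Im \<zeta>))) \<le> indicator (cbox 0 (Complex 1 a)) \<zeta>"
    "cmod (- of_real ((indicator {0..1} (Re \<zeta>) * (1 - Re \<zeta>)) * indicator {0..a} (Im \<zeta>))) \<le> indicator (cbox 0 (Complex 1 a)) \<zeta>"
    unfolding rectangle(4)[OF zero_le_one a] norm_minus_cancel norm_of_real by (auto simp: abs_mult split: split_indicator)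
qed measurable

end

section \<open>The a priori estimate\<close>

lemma square_integrable_iff:
  "square_integrable f \<longleftrightarrow> f \<in> borel_measurable borel \<and> integrable lborel (\<lambda>z. (cmod (f z))\<^sup>2)"
  unfolding square_integrable_def sqnorm_def
  by (auto simp: integrable_iff_bounded ennreal_power)

lemma sqnorm_eq_integral:
  "square_integrable f \<Longrightarrow> sqnorm f = ennreal (\<integral>z. (cmod (f z))\<^sup>2 \<partial>lborel)"
  unfolding square_integrable_iff sqnorm_def
  by (subst nn_integral_eq_integral[symmetric]) (auto simp: ennreal_power)

lemma cmod_add_sq_le: "(cmod (a + b))\<^sup>2 \<le> 2 * (cmod a)\<^sup>2 + 2 * (cmod b)\<^sup>2"
proof -
  have "(cmod (a + b))\<^sup>2 \<le> (cmod a + cmod b)\<^sup>2" by (intro power_mono norm_triangle_ineq) simp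
  also have "\<dots> \<le> 2 * (cmod a)\<^sup>2 + 2 * (cmod b)\<^sup>2"
    using sum_squares_bound[of "cmod a" "cmod b"] by (simp add: power2_sum)
  finally show ?thesis .
qed

lemma square_integrable_add:
  assumes "square_integrable f" "square_integrable g"
  shows "square_integrable (\<lambda>z. f z + g z)"
  unfolding square_integrable_iff
proof
  have [measurable]: "f \<in> borel_measurable borel" "g \<in> borel_measurable borel"
    using assms by (auto simp: square_integrable_iff)
  show "(\<lambda>z. f z + g z) \<in> borel_measurable borel" by measurable
  have "integrable lborel (\<lambda>z. 2 * (cmod (f z))\<^sup>2 + 2 * (cmod (g z))\<^sup>2)"
    using assms by (auto simp: square_integrable_iff)
  then show "integrable lborel (\<lambda>z. (cmod (f z + g z))\<^sup>2)"
    by (rule Bochner_Integration.integrable_bound) (auto intro!: AE_I2 cmod_add_sq_le)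
qed

lemma square_integrable_mult_bounded:
  assumes [measurable]: "m \<in> borel_measurable borel" and b: "\<And>z. cmod (m z) \<le> b" and f: "square_integrable f"
  shows "square_integrable (\<lambda>z. m z * f z)"
  unfolding square_integrable_iff
proof
  have [measurable]: "f \<in> borel_measurable borel" using f by (auto simp: square_integrable_iff)
  show "(\<lambda>z. m z * f z) \<in> borel_measurable borel" by measurable
  have "integrable lborel (\<lambda>z. b\<^sup>2 * (cmod (f z))\<^sup>2)"
    using f by (auto simp: square_integrable_iff)
  then show "integrable lborel (\<lambda>z. (cmod (m z * f z))\<^sup>2)"
    by (rule Bochner_Integration.integrable_bound)
       (auto intro!: AE_I2 mult_right_mono power_mono b simp: norm_mult power_mult_distrib)
qed

lemmas square_integrable_cmult = square_integrable_mult_bounded[of "\<lambda>_. c" "cmod c" for c, simplified]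

lemma integrable_mult_square_integrable:
  assumes "square_integrable f" "square_integrable g"
  shows "integrable lborel (\<lambda>z. f z * g z)"
proof -
  have [measurable]: "f \<in> borel_measurable borel" "g \<in> borel_measurable borel"
    using assms by (auto simp: square_integrable_iff)
  have "integrable lborel (\<lambda>z. (cmod (f z))\<^sup>2 + (cmod (g z))\<^sup>2)"
    using assms by (auto simp: square_integrable_iff)
  then show ?thesis
  proof (rule Bochner_Integration.integrable_bound)
    have "cmod (f z * g z) \<le> (cmod (f z))\<^sup>2 + (cmod (g z))\<^sup>2" for z
      using sum_squares_bound[of "cmod (f z)" "cmod (g z)"] mult_nonneg_nonneg[of "cmod (f z)" "cmod (g z)"]
      by (simp add: norm_mult del: mult_nonneg_nonneg)
    then show "AE z in lborel. norm (f z * g z) \<le> norm ((cmod (f z))\<^sup>2 + (cmod (g z))\<^sup>2)"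
      by (auto intro!: AE_I2)
  qed measurable
qed

context smooth_window
begin

lemma nn_integral_Lipschitz_weight:
  assumes "0 \<le> L"
  shows "(\<integral>\<^sup>+t. ennreal (cmod (tensor r' r t) * (L * cmod t)) \<partial>lborel) \<le> ennreal (4 * L)"
proof -
  have "(\<integral>\<^sup>+t. ennreal (cmod (tensor r' r t) * (L * cmod t)) \<partial>lborel)
     = (\<integral>\<^sup>+t. ennreal L * ennreal (cmod (tensor r' r t) * cmod t) \<partial>lborel)"
    using assms by (intro nn_integral_cong) (simp add: ennreal_mult[symmetric] ac_simps)
  also have "\<dots> = ennreal L * (\<integral>\<^sup>+t. ennreal (cmod (tensor r' r t) * cmod t) \<partial>lborel)"
    by (rule nn_integral_cmult) measurable
  also have "\<dots> \<le> ennreal L * ennreal 4"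
    by (intro mult_left_mono nn_integral_tensor'_norm) simp
  also have "\<dots> = ennreal (4 * L)" using assms by (metis ennreal_mult mult.commute zero_le_numeral)
  finally show ?thesis .
qed

text \<open>The commutator of multiplication by \<open>m\<close> with the regularisation has kernel \<open>\<rho>\<^sub>x(t - z) (m t - m z)\<close>, dominated
by \<open>L \<bar>\<rho>\<^sub>x(t - z)\<bar> \<bar>t - z\<bar>\<close>, to which Young's inequality applies.\<close>

lemma commutator_bound:
  assumes L: "0 \<le> L" "\<And>s t. cmod (m s - m t) \<le> L * cmod (s - t)"
    and m[measurable]: "m \<in> borel_measurable borel"
    and f: "locally_integrable f" and mf: "locally_integrable (\<lambda>t. m t * f t)"
  shows "sqnorm (\<lambda>z. corr (tensor r' r) (\<lambda>t. m t * f t) z - m z * corr (tensor r' r) f z)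
    \<le> ennreal ((4 * L)\<^sup>2) * sqnorm f"
proof -
  have [measurable]: "f \<in> borel_measurable borel" using f by (simp add: locally_integrable_def)
  let ?\<kappa> = "\<lambda>t. ennreal (cmod (tensor r' r t) * (L * cmod t))"
  have "sqnorm (\<lambda>z. corr (tensor r' r) (\<lambda>t. m t * f t) z - m z * corr (tensor r' r) f z)
     \<le> (\<integral>\<^sup>+z. (\<integral>\<^sup>+t. ?\<kappa> (t - z) * ennreal (cmod (f t)) \<partial>lborel)\<^sup>2 \<partial>lborel)"
    unfolding sqnorm_def
  proof (intro nn_integral_mono power_mono)
    fix z
    let ?e = "\<lambda>t. tensor r' r (t - z) * (m t * f t) - m z * (tensor r' r (t - z) * f t)"
    have int: "integrable lborel (\<lambda>t. tensor r' r (t - z) * (m t * f t))"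
      "integrable lborel (\<lambda>t. m z * (tensor r' r (t - z) * f t))"
      using integrable_corr[OF tensor_cc(2) mf] integrable_corr[OF tensor_cc(2) f] by auto
    have eq: "corr (tensor r' r) (\<lambda>t. m t * f t) z - m z * corr (tensor r' r) f z = (\<integral>t. ?e t \<partial>lborel)"
      using int by (simp add: corr_def)
    have "ennreal (cmod (corr (tensor r' r) (\<lambda>t. m t * f t) z - m z * corr (tensor r' r) f z))
        \<le> (\<integral>\<^sup>+t. ennreal (cmod (?e t)) \<partial>lborel)"
      unfolding eq by (rule integral_norm_bound_ennreal) (use int in auto)
    also have "\<dots> \<le> (\<integral>\<^sup>+t. ?\<kappa> (t - z) * ennreal (cmod (f t)) \<partial>lborel)"
    proof (rule nn_integral_mono)
      fix t
      have "cmod (?e t) = cmod (tensor r' r (t - z) * (m t - m z) * f t)"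
        by (rule arg_cong[of _ _ cmod]) (simp only: left_diff_distrib right_diff_distrib mult_ac)
      also have "\<dots> \<le> cmod (tensor r' r (t - z)) * (L * cmod (t - z)) * cmod (f t)"
        unfolding norm_mult by (intro mult_right_mono mult_left_mono L norm_ge_zero)
      finally have "ennreal (cmod (?e t))
          \<le> ennreal (cmod (tensor r' r (t - z)) * (L * cmod (t - z)) * cmod (f t))"
        by (rule ennreal_leI)
      also have "\<dots> = ?\<kappa> (t - z) * ennreal (cmod (f t))"
        using L(1) by (subst ennreal_mult) simp_all
      finally show "ennreal (cmod (?e t)) \<le> ?\<kappa> (t - z) * ennreal (cmod (f t))" .
    qed
    finally show "ennreal (cmod (corr (tensor r' r) (\<lambda>t. m t * f t) z - m z * corr (tensor r' r) f z))
      \<le> (\<integral>\<^sup>+t. ?\<kappa> (t - z) * ennreal (cmod (f t)) \<partial>lborel)" .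
  qed simp
  also have "\<dots> \<le> (\<integral>\<^sup>+t. ?\<kappa> t \<partial>lborel)\<^sup>2 * sqnorm f"
    unfolding sqnorm_def by (rule nn_Young) measurable
  also have "\<dots> \<le> (ennreal (4 * L))\<^sup>2 * sqnorm f"
    by (intro mult_right_mono power_mono nn_integral_Lipschitz_weight L) simp_all
  finally show ?thesis using L(1) by (simp add: ennreal_power)
qed

lemma integral_tensor': "(\<integral>t. tensor r' r t \<partial>lborel) = 0"
proof -
  have "(\<integral>x. r' x * indicator {-1..2} x \<partial>lborel) = r 2 - r (-1)"
    by (rule integral_FTC_Icc_real) (auto intro: deriv isCont_r')
  moreover have "(\<lambda>x. r' x * indicator {-1..2} x) = r'"
  proof
    fix x show "r' x * indicator {-1..2} x = r' x"
      using h by (cases "x \<in> {-1..2}") (auto simp: r'_eq_0)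
  qed
  ultimately have 0: "(\<integral>x. r' x \<partial>lborel) = 0" using h by (simp add: r_eq_0)
  have "integrable lborel r" "integrable lborel r'"
    by (rule integrable_compact_support[of _ 0 h]; use cont_r cont_r' r_eq_0 r'_eq_0 in blast)+
  then show ?thesis
    unfolding tensor_def by (subst integral_tensor_mult) (auto simp: 0)
qed

lemma tensor'_eq_0: "2 < cmod t \<Longrightarrow> tensor r' r t = 0"
proof -
  assume t: "2 < cmod t"
  have "2 < \<bar>Re t\<bar> + \<bar>Im t\<bar>" using cmod_le[of t] t by linarith
  then have "Re t \<notin> {0..h} \<or> Im t \<notin> {0..h}" using h by auto
  then show ?thesis using r_eq_0 r'_eq_0 by (auto simp: tensor_def)
qed

text \<open>As \<open>\<rho>\<^sub>x\<close> has integral zero, \<open>f t\<close> may be replaced by \<open>f t - f z\<close>, and the Lipschitz condition again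
compensates the derivative of the kernel. Outside \<open>cball 0 (R + 2)\<close> the correlation vanishes, since the kernel is
supported in \<open>cball 0 2\<close>.\<close>

lemma sqnorm_corr_Lipschitz_le:
  assumes L: "0 \<le> L" "\<And>s t. cmod (f s - f t) \<le> L * cmod (s - t)"
    and f: "locally_integrable f" and R: "\<And>t. cmod t > R \<Longrightarrow> f t = 0"
  shows "sqnorm (corr (tensor r' r) f) \<le> ennreal ((4 * L)\<^sup>2) * emeasure lborel (cball (0::complex) (R + 2))"
proof -
  have "sqnorm (corr (tensor r' r) f) \<le> (\<integral>\<^sup>+z. ennreal ((4 * L)\<^sup>2) * indicator (cball (0::complex) (R + 2)) z \<partial>lborel)"
    unfolding sqnorm_def
  proof (rule nn_integral_mono)
    fix z :: complex
    have const: "locally_integrable (\<lambda>_. f z)"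
      unfolding locally_integrable_def set_integrable_def
      by (auto intro!: integrable_scaleR_left integrable_real_indicator emeasure_bounded_finite)
    have "(\<integral>t. tensor r' r (t - z) \<partial>lborel) = (\<integral>t. tensor r' r t \<partial>distr lborel borel ((+) (- z)))"
      by (subst integral_distr) simp_all
    then have 0: "(\<integral>t. tensor r' r (t - z) \<partial>lborel) = 0"
      by (simp add: lborel_distr_plus integral_tensor')
    have "corr (tensor r' r) f z = (\<integral>t. tensor r' r (t - z) * f t - tensor r' r (t - z) * f z \<partial>lborel)"
      using integrable_corr[OF tensor_cc(2) f, of z] integrable_corr[OF tensor_cc(2) const, of z]
      by (simp add: corr_def 0)
    also have "ennreal (cmod \<dots>) \<le> (\<integral>\<^sup>+t. ennreal (cmod (tensor r' r (t - z) * f t - tensor r' r (t - z) * f z)) \<partial>lborel)"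
      using integrable_corr[OF tensor_cc(2) f, of z] integrable_corr[OF tensor_cc(2) const, of z]
      by (intro integral_norm_bound_ennreal) auto
    also have "\<dots> \<le> (\<integral>\<^sup>+t. ennreal (cmod (tensor r' r (t - z)) * (L * cmod (t - z))) \<partial>lborel)"
      using L by (intro nn_integral_mono ennreal_leI) (simp add: norm_mult mult_left_mono flip: right_diff_distrib)
    also have "\<dots> = (\<integral>\<^sup>+t. ennreal (cmod (tensor r' r t) * (L * cmod t)) \<partial>lborel)"
      using nn_integral_complex_shift[of "\<lambda>t. ennreal (cmod (tensor r' r t) * (L * cmod t))" "- z"] by simp
    also have "\<dots> \<le> ennreal (4 * L)" by (rule nn_integral_Lipschitz_weight[OF L(1)])
    finally have le: "ennreal (cmod (corr (tensor r' r) f z)) \<le> ennreal (4 * L)" .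
    show "(ennreal (cmod (corr (tensor r' r) f z)))\<^sup>2 \<le> ennreal ((4 * L)\<^sup>2) * indicator (cball (0::complex) (R + 2)) z"
    proof (cases "z \<in> cball 0 (R + 2)")
      case True
      then show ?thesis using power_mono[OF le, of 2] L(1) by (simp add: ennreal_power)
    next
      case False
      then have z: "cmod z > R + 2" by simp
      have "tensor r' r (t - z) * f t = 0" for t
      proof (cases "2 < cmod (t - z)")
        case False
        then have "cmod t > R" using z norm_triangle_ineq2[of z t] by (simp add: norm_minus_commute)
        then show ?thesis using R by simp
      qed (simp add: tensor'_eq_0)
      then have "corr (tensor r' r) f z = 0"
        by (simp only: corr_def Bochner_Integration.integral_zero)
      then show ?thesis by simp
    qed
  qed
  then show ?thesis by (simp add: nn_integral_cmult)
qed

end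

text \<open>The hypotheses of the theorem for Borel functions and Borel measure, with \<open>P\<close> and \<open>Q\<close> in the role of the weak
partial derivatives. The equation is in the form it takes after the weak derivatives have been inserted.\<close>

locale beltrami_solution =
  fixes \<mu> F g P Q :: "complex \<Rightarrow> complex" and k :: real
  assumes \<mu>: "\<mu> \<in> Cc_infinity" and F: "F \<in> Cc_infinity"
    and \<mu>_le: "\<And>z. cmod (\<mu> z) \<le> k" and k: "k < 1"
    and g: "locally_integrable g" and P: "square_integrable P" and Q: "square_integrable Q"
    and weak_x: "\<And>\<phi>. \<phi> \<in> Cc_infinity \<Longrightarrow> (\<integral>t. partial 1 \<phi> t * g t \<partial>lborel) = - (\<integral>t. \<phi> t * P t \<partial>lborel)"
    and weak_y: "\<And>\<phi>. \<phi> \<in> Cc_infinity \<Longrightarrow> (\<integral>t. partial \<i> \<phi> t * g t \<partial>lborel) = - (\<integral>t. \<phi> t * Q t \<partial>lborel)"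
    and equation: "\<And>\<phi>. \<phi> \<in> Cc_infinity \<Longrightarrow>
       (\<integral>t. \<phi> t * ((P t + \<i> * Q t) / 2) \<partial>lborel)
         = (\<integral>t. \<phi> t * (\<mu> t * ((P t - \<i> * Q t) / 2)) \<partial>lborel) + (\<integral>t. \<phi> t * F t \<partial>lborel)"
begin

lemma k_nonneg: "0 \<le> k" using \<mu>_le[of 0] norm_ge_zero order_trans by blast

definition "dz t = (P t - \<i> * Q t) / 2"
definition "dzbar t = (P t + \<i> * Q t) / 2"

lemma dz: "square_integrable dz" and dzbar: "square_integrable dzbar"
proof -
  have "dz = (\<lambda>t. (1/2) * P t + (- \<i> / 2) * Q t)" "dzbar = (\<lambda>t. (1/2) * P t + (\<i> / 2) * Q t)"
    by (auto simp: dz_def dzbar_def field_simps)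
  then show "square_integrable dz" "square_integrable dzbar"
    by (simp_all only:) (intro square_integrable_add square_integrable_cmult P Q)+
qed

lemma corr_partial:
  assumes "\<phi> \<in> Cc_infinity"
  shows "corr (partial 1 \<phi>) g z = - corr \<phi> P z" "corr (partial \<i> \<phi>) g z = - corr \<phi> Q z"
proof -
  have "partial e (\<lambda>t. \<phi> (t - z)) = (\<lambda>t. partial e \<phi> (t - z))" for e
    by (rule partial_shift) (rule smooth_differentiable[OF Cc_infinityD(1)[OF assms]])
  then show "corr (partial 1 \<phi>) g z = - corr \<phi> P z" "corr (partial \<i> \<phi>) g z = - corr \<phi> Q z"
    using weak_x[OF Cc_infinity_shift[OF assms], of z] weak_y[OF Cc_infinity_shift[OF assms], of z]
    by (simp_all add: corr_def)
qed

lemma corr_dz: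
  assumes "cc_kernel \<phi>"
  shows "corr \<phi> dz z = (corr \<phi> P z - \<i> * corr \<phi> Q z) / 2"
    "corr \<phi> dzbar z = (corr \<phi> P z + \<i> * corr \<phi> Q z) / 2"
proof -
  note i = integrable_corr[OF assms square_integrable_imp_locally_integrable[OF P], of z] integrable_corr[OF assms square_integrable_imp_locally_integrable[OF Q], of z]
  have "(\<lambda>t. \<phi> (t - z) * dz t) = (\<lambda>t. (\<phi> (t - z) * P t - \<i> * (\<phi> (t - z) * Q t)) / 2)"
    "(\<lambda>t. \<phi> (t - z) * dzbar t) = (\<lambda>t. (\<phi> (t - z) * P t + \<i> * (\<phi> (t - z) * Q t)) / 2)"
    by (auto simp: dz_def dzbar_def field_simps)
  then show "corr \<phi> dz z = (corr \<phi> P z - \<i> * corr \<phi> Q z) / 2"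
    "corr \<phi> dzbar z = (corr \<phi> P z + \<i> * corr \<phi> Q z) / 2"
    using i by (simp_all add: corr_def)
qed

text \<open>This is convexity of the square at the point \<open>k b + (1 - k) (e / (1 - k))\<close>.\<close>

lemma convexity: "(k * b + e)\<^sup>2 \<le> k * b\<^sup>2 + e\<^sup>2 / (1 - k)" for b e :: real
proof -
  have "k * b\<^sup>2 + e\<^sup>2 / (1 - k) - (k * b + e)\<^sup>2 = k * ((1 - k) * b - e)\<^sup>2 / (1 - k)"
    using k by (simp add: field_simps power2_eq_square)
  also have "\<dots> \<ge> 0" using k k_nonneg by simp
  finally show ?thesis by simp
qed

text \<open>Test the equation with the translates of \<open>\<rho>\<^sub>x\<close> to get \<open>A = \<mu> B + E\<close>. By the energy identity \<open>A\<close> and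
\<open>B\<close> have the same norm \<open>b\<close>, so \<open>b\<^sup>2 \<le> k b\<^sup>2 + \<parallel>E\<parallel>\<^sup>2 / (1 - k)\<close>. As \<open>b\<close> is finite, the first term on the right can
be absorbed. The mixed derivative is a combination of \<open>A\<close> and \<open>B\<close>.\<close>

theorem mixed_derivative_bound:
  "\<exists>C\<ge>0. \<forall>r r' r'' h. smooth_window r r' r'' h \<longrightarrow> sqnorm (corr (tensor r' r') g) \<le> ennreal (C\<^sup>2)"
proof -
  obtain L where L: "0 \<le> L" "\<And>s t. cmod (\<mu> s - \<mu> t) \<le> L * cmod (s - t)"
    using Cc_infinity_Lipschitz[OF \<mu>] by blast
  obtain M where M: "0 \<le> M" "\<And>s t. cmod (F s - F t) \<le> M * cmod (s - t)"
    using Cc_infinity_Lipschitz[OF F] by blast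
  obtain R where R: "\<And>t. cmod t > R \<Longrightarrow> F t = 0"
    using Cc_infinityD(2)[OF F] by blast
  have [measurable]: "\<mu> \<in> borel_measurable borel" "F \<in> borel_measurable borel" "dz \<in> borel_measurable borel"
    "P \<in> borel_measurable borel" "Q \<in> borel_measurable borel"
    using cc_kernelD(1)[OF Cc_infinity_cc_kernel] \<mu> F dz P Q by (auto simp: square_integrable_def)
  have F_local: "locally_integrable F"
  proof -
    obtain R' B where B: "0 \<le> B" "\<And>t. cmod (F t) \<le> B * indicator (cball 0 R') t"
      using cc_kernelD(3)[OF Cc_infinity_cc_kernel[OF F]] by blast
    have "integrable lborel (\<lambda>t. B\<^sup>2 * indicator (cball (0::complex) R') t)"
      by (intro integrable_mult_right integrable_real_indicator emeasure_bounded_finite) auto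
    then have "integrable lborel (\<lambda>t. (cmod (F t))\<^sup>2)"
    proof (rule Bochner_Integration.integrable_bound)
      have "norm ((cmod (F t))\<^sup>2) \<le> norm (B\<^sup>2 * indicator (cball 0 R') t)" for t
        using power_mono[OF B(2)[of t], of 2] by (auto split: split_indicator)
      then show "AE t in lborel. norm ((cmod (F t))\<^sup>2) \<le> norm (B\<^sup>2 * indicator (cball 0 R') t)"
        by (intro AE_I2)
    qed measurable
    then show ?thesis by (intro square_integrable_imp_locally_integrable) (simp add: square_integrable_iff)
  qed
  define w where "w = (\<integral>z. (cmod (dz z))\<^sup>2 \<partial>lborel)"
  define v where "v = measure lborel (cball (0::complex) (R + 2))"
  define e where "e = 2 * ((4 * L)\<^sup>2 * w) + 2 * ((4 * M)\<^sup>2 * v)"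
  have e0: "0 \<le> e" by (simp add: e_def w_def v_def)
  have "sqnorm (corr (tensor r' r') g) \<le> ennreal (4 * (e / (1 - k)\<^sup>2))"
    if "smooth_window r r' r'' h" for r r' r'' h
  proof -
    interpret smooth_window r r' r'' h by fact
    define \<alpha> where "\<alpha> = corr (tensor r' r) P"
    define \<beta> where "\<beta> = corr (tensor r r') P"
    define A where "A = corr (tensor r' r) dzbar"
    define B where "B = corr (tensor r' r) dz"
    \<comment> \<open>the mixed derivative of the regularised function can be taken in either order\<close>
    have mixed: "corr (tensor r' r') g z = - \<beta> z" "corr (tensor r' r) Q z = \<beta> z" for z
      using corr_partial(1)[OF tensor_Cc(3), of z] corr_partial(2)[OF tensor_Cc(2), of z]
      by (simp_all add: partials \<beta>_def)
    have sq: "square_integrable \<alpha>" "square_integrable \<beta>" "square_integrable A" "square_integrable B"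
      unfolding \<alpha>_def \<beta>_def A_def B_def by (intro square_integrable_corr tensor_cc P dz dzbar)+
    then have int: "integrable lborel (\<lambda>z. (cmod (A z))\<^sup>2)" "integrable lborel (\<lambda>z. (cmod (B z))\<^sup>2)"
      by (auto simp: square_integrable_iff)
    have AB: "A z = (\<alpha> z + \<i> * \<beta> z) / 2" "B z = (\<alpha> z - \<i> * \<beta> z) / 2" for z
      unfolding A_def B_def corr_dz[OF tensor_cc(2)] mixed \<alpha>_def by simp_all

    \<comment> \<open>polarisation reduces equality of the norms to the energy identity\<close>
    have "(cmod (A z))\<^sup>2 - (cmod (B z))\<^sup>2 = Im (\<alpha> z * cnj (\<beta> z))" for z
      unfolding AB cmod_power2 by (simp add: power2_eq_square field_simps)
    then have "(\<integral>z. (cmod (A z))\<^sup>2 \<partial>lborel) - (\<integral>z. (cmod (B z))\<^sup>2 \<partial>lborel) = (\<integral>z. Im (\<alpha> z * cnj (\<beta> z)) \<partial>lborel)"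
      using int by (simp flip: Bochner_Integration.integral_diff)
    also have "\<dots> = Im (\<integral>z. \<alpha> z * cnj (\<beta> z) \<partial>lborel)"
    proof -
      have "square_integrable (\<lambda>z. cnj (\<beta> z))"
        using sq(2) borel_measurable_continuous_on[of cnj \<beta> lborel]
        by (simp add: square_integrable_iff continuous_on_cnj)
      from integrable_mult_square_integrable[OF sq(1) this] show ?thesis by (rule integral_Im)
    qed
    also have "\<dots> = 0" unfolding \<alpha>_def \<beta>_def by (rule energy_identity[OF P])
    finally have energy: "(\<integral>z. (cmod (A z))\<^sup>2 \<partial>lborel) = (\<integral>z. (cmod (B z))\<^sup>2 \<partial>lborel)" by simp

    have \<mu>dz: "square_integrable (\<lambda>t. \<mu> t * dz t)"
      by (rule square_integrable_mult_bounded[OF _ \<mu>_le dz]) measurable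
    define E1 where "E1 = (\<lambda>z. corr (tensor r' r) (\<lambda>t. \<mu> t * dz t) z - \<mu> z * B z)"
    define E2 where "E2 = corr (tensor r' r) F"
    have [measurable]: "E2 \<in> borel_measurable borel" "E1 \<in> borel_measurable borel"
      unfolding E1_def E2_def B_def by measurable
    have A: "A z = \<mu> z * B z + (E1 z + E2 z)" for z
      using equation[OF Cc_infinity_shift[OF tensor_Cc(2)], of z]
      by (simp add: A_def E1_def E2_def corr_def dz_def dzbar_def)
    have "sqnorm E1 \<le> ennreal ((4 * L)\<^sup>2) * sqnorm dz"
      unfolding E1_def B_def by (rule commutator_bound[OF L _ square_integrable_imp_locally_integrable[OF dz] square_integrable_imp_locally_integrable[OF \<mu>dz]]) measurable
    then have E1: "sqnorm E1 \<le> ennreal ((4 * L)\<^sup>2 * w)"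
      unfolding sqnorm_eq_integral[OF dz] w_def by (subst ennreal_mult) simp_all
    have "emeasure lborel (cball (0::complex) (R + 2)) = ennreal v"
      unfolding v_def using emeasure_bounded_finite[of "cball (0::complex) (R + 2)"]
      by (intro emeasure_eq_ennreal_measure) auto
    then have E2: "sqnorm E2 \<le> ennreal ((4 * M)\<^sup>2 * v)"
      using sqnorm_corr_Lipschitz_le[of M F R, OF M F_local R]
      by (subst ennreal_mult) (simp_all add: E2_def v_def)
    have E12: "square_integrable E1" "square_integrable E2"
      using le_less_trans[OF E1 ennreal_less_top] le_less_trans[OF E2 ennreal_less_top]
      by (simp_all add: square_integrable_def)
    have E: "(\<integral>z. (cmod (E1 z))\<^sup>2 \<partial>lborel) \<le> (4 * L)\<^sup>2 * w" "(\<integral>z. (cmod (E2 z))\<^sup>2 \<partial>lborel) \<le> (4 * M)\<^sup>2 * v"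
      using E1 E2 unfolding sqnorm_eq_integral[OF E12(1)] sqnorm_eq_integral[OF E12(2)]
      by (auto simp: w_def v_def)
    note E12' = E12[unfolded square_integrable_iff, THEN conjunct2]

    \<comment> \<open>absorption: the energy identity bounds the squared norm of \<open>B\<close> by \<open>k\<close> times itself plus an error\<close>
    let ?b = "\<integral>z. (cmod (B z))\<^sup>2 \<partial>lborel"
    have "?b = (\<integral>z. (cmod (A z))\<^sup>2 \<partial>lborel)" by (simp add: energy)
    also have "\<dots> \<le> (\<integral>z. k * (cmod (B z))\<^sup>2 + (2 * (cmod (E1 z))\<^sup>2 + 2 * (cmod (E2 z))\<^sup>2) / (1 - k) \<partial>lborel)"
    proof (rule integral_mono)
      fix z
      have "cmod (A z) \<le> k * cmod (B z) + cmod (E1 z + E2 z)"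
        unfolding A using norm_triangle_ineq[of "\<mu> z * B z" "E1 z + E2 z"] mult_right_mono[OF \<mu>_le[of z], of "cmod (B z)"]
        by (simp add: norm_mult)
      then have "(cmod (A z))\<^sup>2 \<le> (k * cmod (B z) + cmod (E1 z + E2 z))\<^sup>2" by (rule power_mono) simp
      also have "\<dots> \<le> k * (cmod (B z))\<^sup>2 + (cmod (E1 z + E2 z))\<^sup>2 / (1 - k)" by (rule convexity)
      also have "\<dots> \<le> k * (cmod (B z))\<^sup>2 + (2 * (cmod (E1 z))\<^sup>2 + 2 * (cmod (E2 z))\<^sup>2) / (1 - k)"
        using k by (intro add_left_mono divide_right_mono cmod_add_sq_le) simp
      finally show "(cmod (A z))\<^sup>2 \<le> k * (cmod (B z))\<^sup>2 + (2 * (cmod (E1 z))\<^sup>2 + 2 * (cmod (E2 z))\<^sup>2) / (1 - k)" .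
    qed (use int E12' in auto)
    also have "\<dots> = k * ?b + (2 * (\<integral>z. (cmod (E1 z))\<^sup>2 \<partial>lborel) + 2 * (\<integral>z. (cmod (E2 z))\<^sup>2 \<partial>lborel)) / (1 - k)"
      using int E12' by simp
    also have "\<dots> \<le> k * ?b + e / (1 - k)"
      using E k by (intro add_left_mono divide_right_mono) (auto simp: e_def)
    finally have "(1 - k) * ?b \<le> e / (1 - k)" by (simp add: algebra_simps)
    then have "?b \<le> e / (1 - k) / (1 - k)" using k by (simp add: pos_le_divide_eq mult.commute)
    then have b: "?b \<le> e / (1 - k)\<^sup>2" by (simp add: power2_eq_square)

    have "(\<integral>z. (cmod (\<beta> z))\<^sup>2 \<partial>lborel) \<le> (\<integral>z. 2 * (cmod (A z))\<^sup>2 + 2 * (cmod (B z))\<^sup>2 \<partial>lborel)"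
    proof (rule integral_mono)
      show "integrable lborel (\<lambda>z. (cmod (\<beta> z))\<^sup>2)"
        using sq(2) by (simp add: square_integrable_iff)
      show "integrable lborel (\<lambda>z. 2 * (cmod (A z))\<^sup>2 + 2 * (cmod (B z))\<^sup>2)"
        by (intro Bochner_Integration.integrable_add integrable_mult_right int)
      fix z
      have eq: "\<beta> z = - \<i> * A z + \<i> * B z"
        unfolding AB by (rule complex_eqI) (simp_all add: field_simps)
      have "cmod (- \<i> * A z) = cmod (A z)" "cmod (\<i> * B z) = cmod (B z)"
        by (simp_all add: norm_mult)
      with cmod_add_sq_le[of "- \<i> * A z" "\<i> * B z"]
      show "(cmod (\<beta> z))\<^sup>2 \<le> 2 * (cmod (A z))\<^sup>2 + 2 * (cmod (B z))\<^sup>2"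
        unfolding eq by metis
    qed
    also have "\<dots> = 4 * ?b" using int energy by simp
    finally have "(\<integral>z. (cmod (\<beta> z))\<^sup>2 \<partial>lborel) \<le> 4 * (e / (1 - k)\<^sup>2)" using b by simp
    then have "sqnorm \<beta> \<le> ennreal (4 * (e / (1 - k)\<^sup>2))"
      unfolding sqnorm_eq_integral[OF sq(2)] by (rule ennreal_leI)
    moreover have "sqnorm (corr (tensor r' r') g) = sqnorm \<beta>" by (simp add: sqnorm_def mixed)
    ultimately show ?thesis by simp
  qed
  note bound = this
  have "0 \<le> 4 * (e / (1 - k)\<^sup>2)" using e0 by simp
  then have "0 \<le> sqrt (4 * (e / (1 - k)\<^sup>2))" "(sqrt (4 * (e / (1 - k)\<^sup>2)))\<^sup>2 = 4 * (e / (1 - k)\<^sup>2)"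
    by (rule real_sqrt_ge_zero, rule real_sqrt_pow2)
  with bound show ?thesis
    by (intro exI[of _ "sqrt (4 * (e / (1 - k)\<^sup>2))"] conjI allI impI) (simp_all only:)
qed

end

section \<open>Passage to averages over squares\<close>

text \<open>For large \<open>N\<close> both factors are close to 1 inside \<open>[0, h]\<close>, while each of them vanishes beyond one endpoint. The first factor increases and
the second decreases, which bounds the total variation by \<open>2/h\<close> whatever \<open>N\<close> is.\<close>

definition bump :: "real \<Rightarrow> real \<Rightarrow> real \<Rightarrow> real" where
  "bump N h x = flat 0 (N * x) * flat 0 (N * (h - x)) / h"

definition bump' :: "real \<Rightarrow> real \<Rightarrow> real \<Rightarrow> real" where
  "bump' N h x = N * (flat 2 (N * x) * flat 0 (N * (h - x)) - flat 0 (N * x) * flat 2 (N * (h - x))) / h"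

lemma flat_nonneg: "0 \<le> flat n x"
  by (simp add: flat_def)

lemma flat0_le_1: "flat 0 x \<le> 1"
  by (simp add: flat_def)

lemma flat0_deriv: "(flat 0 has_real_derivative flat 2 x) (at x)"
proof -
  have "flat (0 + 2) x - real 0 * flat (0 + 1) x = flat 2 x"
    by (simp only: add_0 of_nat_0 mult_zero_left diff_zero)
  with flat_deriv[of 0 x] show ?thesis by metis
qed

lemma flat0_deriv_affine:
  "((\<lambda>x. flat 0 (N * x)) has_real_derivative N * flat 2 (N * x)) (at x)"
  "((\<lambda>x. flat 0 (N * (h - x))) has_real_derivative - N * flat 2 (N * (h - x))) (at x)"
proof -
  have "((\<lambda>x. N * x) has_real_derivative N) (at x)" "((\<lambda>x. N * (h - x)) has_real_derivative - N) (at x)"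
    by (auto intro!: derivative_eq_intros)
  from DERIV_chain2[OF flat0_deriv this(1)] DERIV_chain2[OF flat0_deriv this(2)]
  show "((\<lambda>x. flat 0 (N * x)) has_real_derivative N * flat 2 (N * x)) (at x)"
    "((\<lambda>x. flat 0 (N * (h - x))) has_real_derivative - N * flat 2 (N * (h - x))) (at x)"
    by (simp_all only: mult.commute)
qed

lemma flat_differentiable_affine:
  "(\<lambda>x. flat n (N * x)) differentiable (at x)" "(\<lambda>x. flat n (N * (h - x))) differentiable (at (x :: real))"
proof -
  have f: "flat n differentiable (at y)" for y
    using flat_deriv real_differentiable_def by blast
  have d: "(\<lambda>x. N * x) differentiable (at x)" "(\<lambda>x. N * (h - x)) differentiable (at x)"
    by (intro differentiable_mult differentiable_diff differentiable_const differentiable_ident)+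
  show "(\<lambda>x. flat n (N * x)) differentiable (at x)" "(\<lambda>x. flat n (N * (h - x))) differentiable (at x)"
    by (rule differentiable_compose[OF f d(1)], rule differentiable_compose[OF f d(2)])
qed

lemma smooth_window_bump:
  assumes N: "0 < N" and h: "0 < h" "h \<le> 1"
  shows "smooth_window (bump N h) (bump' N h) (deriv (bump' N h)) h"
proof
  show "0 < h" "h \<le> 1" by fact+
  show "(bump N h has_real_derivative bump' N h x) (at x)" for x
    unfolding bump_def[abs_def] bump'_def
    by (rule derivative_eq_intros flat0_deriv_affine refl)+ (use h in \<open>simp_all add: field_simps\<close>)
  have "bump' N h differentiable (at x)" for x
    unfolding bump'_def[abs_def] using h
    by (intro derivative_intros flat_differentiable_affine) auto
  then show "(bump' N h has_real_derivative deriv (bump' N h) x) (at x)" for x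
    by (simp add: DERIV_deriv_iff_real_differentiable)
  show "0 \<le> bump N h x" for x using h by (simp add: bump_def flat_nonneg)
  show "bump N h x \<le> indicator {0..h} x / h" for x
  proof -
    have "flat 0 (N * x) * flat 0 (N * (h - x)) \<le> indicator {0..h} x"
    proof (cases "x \<in> {0..h}")
      case True
      then show ?thesis using mult_mono[OF flat0_le_1[of "N * x"] flat0_le_1[of "N * (h - x)"]]
        by (simp add: flat_nonneg)
    next
      case False
      then have "N * x \<le> 0 \<or> N * (h - x) \<le> 0" using N by (auto simp: mult_le_0_iff)
      then show ?thesis by (auto simp: flat_def)
    qed
    then show ?thesis using h unfolding bump_def by (intro divide_right_mono) auto
  qed
  show "(\<integral>\<^sup>+x. ennreal \<bar>bump' N h x\<bar> \<partial>lborel) \<le> ennreal (2 / h)"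
  proof -
    let ?f = "\<lambda>x. (N * flat 2 (N * x) + N * flat 2 (N * (h - x))) / h"
    let ?F = "\<lambda>x. (flat 0 (N * x) - flat 0 (N * (h - x))) / h"
    \<comment> \<open>\<open>?f\<close> is the sum of the absolute derivatives of the two monotone factors, divided by \<open>h\<close>\<close>
    have "(\<integral>\<^sup>+x. ennreal \<bar>bump' N h x\<bar> \<partial>lborel) \<le> (\<integral>\<^sup>+x. ennreal (?f x) * indicator {0..h} x \<partial>lborel)"
    proof (rule nn_integral_mono)
      fix x
      show "ennreal \<bar>bump' N h x\<bar> \<le> ennreal (?f x) * indicator {0..h} x"
      proof (cases "x \<in> {0..h}")
        case True
        let ?a = "flat 2 (N * x) * flat 0 (N * (h - x))" and ?b = "flat 0 (N * x) * flat 2 (N * (h - x))"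
        have a: "0 \<le> ?a" "?a \<le> flat 2 (N * x)" and b: "0 \<le> ?b" "?b \<le> flat 2 (N * (h - x))"
          using mult_left_mono[OF flat0_le_1 flat_nonneg] mult_right_mono[OF flat0_le_1 flat_nonneg]
          by (auto simp: flat_nonneg)
        then have "\<bar>?a - ?b\<bar> \<le> flat 2 (N * x) + flat 2 (N * (h - x))" by linarith
        then have "N * \<bar>?a - ?b\<bar> / h \<le> N * (flat 2 (N * x) + flat 2 (N * (h - x))) / h"
          using N h by (intro divide_right_mono mult_left_mono) auto
        moreover have "\<bar>bump' N h x\<bar> = N * \<bar>?a - ?b\<bar> / h"
          using N h by (simp add: bump'_def abs_mult)
        ultimately have "\<bar>bump' N h x\<bar> \<le> ?f x"
          by (simp add: distrib_left)
        then show ?thesis using True by (simp add: ennreal_leI)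
      next
        case False
        then have "N * x \<le> 0 \<or> N * (h - x) \<le> 0" using N by (auto simp: mult_le_0_iff)
        then have "bump' N h x = 0" by (auto simp: bump'_def flat_def)
        then show ?thesis by simp
      qed
    qed
    also have "\<dots> = ?F h - ?F 0"
    proof (rule nn_integral_FTC_Icc)
      have "continuous_on UNIV (flat 2)"
        by (rule DERIV_continuous_on[OF has_field_derivative_at_within[OF flat_deriv]])
      then have [measurable]: "flat 2 \<in> borel_measurable borel" by (rule borel_measurable_continuous_onI)
      show "?f \<in> borel_measurable borel" by measurable
      show "(?F has_real_derivative ?f x) (at x)" for x
        by (rule derivative_eq_intros flat0_deriv_affine refl)+ (use h in \<open>simp_all add: field_simps\<close>)
      show "0 \<le> ?f x" for x using N h by (simp add: flat_nonneg)
    qed (use h in simp)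
    also have "?F h - ?F 0 = 2 * flat 0 (N * h) / h" by (simp add: flat_def)
    also have "ennreal \<dots> \<le> ennreal (2 / h)"
      using h flat0_le_1[of "N * h"] by (intro ennreal_leI divide_right_mono) auto
    finally show ?thesis .
  qed
  show "smooth (tensor (bump N h) (bump N h))"
  proof -
    have l: "bounded_linear (\<lambda>t. N * Re t)" "bounded_linear (\<lambda>t. - N * Re t)"
      "bounded_linear (\<lambda>t. N * Im t)" "bounded_linear (\<lambda>t. - N * Im t)"
      by (intro bounded_linear_const_mult bounded_linear_Re bounded_linear_Im)+
    have "tensor (bump N h) (bump N h) =
      (\<lambda>t. of_real (1 / h\<^sup>2) * ((of_real (flat 0 (N * Re t + 0)) * of_real (flat 0 (- N * Re t + N * h)))
        * (of_real (flat 0 (N * Im t + 0)) * of_real (flat 0 (- N * Im t + N * h)))))"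
      by (simp add: fun_eq_iff tensor_def bump_def power2_eq_square algebra_simps)
    then show ?thesis
      by (simp only:) (intro smooth_mult smooth_flat l, simp add: C_k_const)
  qed
qed

lemma bump_tendsto:
  assumes h: "0 < h"
  shows "(\<lambda>n. bump (real (Suc n)) h x) \<longlonglongrightarrow> indicator {0<..<h} x / h"
proof (cases "x \<in> {0<..<h}")
  case True
  have flat: "(\<lambda>n. flat 0 (real (Suc n) * y)) \<longlonglongrightarrow> 1" if "0 < y" for y
  proof -
    have "(\<lambda>n. - (1 / y) * inverse (real (Suc n))) \<longlonglongrightarrow> - (1 / y) * 0"
      by (rule tendsto_mult_left[OF LIMSEQ_inverse_real_of_nat])
    then have "(\<lambda>n. exp (- (1 / y) * inverse (real (Suc n)))) \<longlonglongrightarrow> exp (- (1 / y) * 0)"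
      by (rule tendsto_exp)
    moreover have "(\<lambda>n. exp (- (1 / y) * inverse (real (Suc n)))) = (\<lambda>n. flat 0 (real (Suc n) * y))"
    proof
      fix n
      have "0 < real (Suc n) * y" using that by (intro mult_pos_pos of_nat_0_less_iff[THEN iffD2]) auto
      then show "exp (- (1 / y) * inverse (real (Suc n))) = flat 0 (real (Suc n) * y)"
        unfolding flat_def by (simp only: not_le[symmetric] if_False) (simp add: divide_inverse del: of_nat_Suc)
    qed
    ultimately show ?thesis by (simp only: mult_zero_right exp_zero)
  qed
  have "(\<lambda>n. bump (real (Suc n)) h x) \<longlonglongrightarrow> 1 * 1 / h"
    unfolding bump_def using True h by (intro tendsto_divide tendsto_mult flat tendsto_const) (simp_all del: of_nat_Suc)
  then show ?thesis using True by simp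
next
  case False
  then have "real (Suc n) * x \<le> 0 \<or> real (Suc n) * (h - x) \<le> 0" for n
    by (auto simp: mult_le_0_iff)
  note le = this
  have "bump (real (Suc n)) h x = 0" for n
    using le[of n] by (elim disjE) (simp_all add: bump_def flat_def del: of_nat_Suc)
  then have "(\<lambda>n. bump (real (Suc n)) h x) = (\<lambda>_. 0)" by (intro ext)
  then show ?thesis using False by simp
qed

text \<open>The square has \<open>z\<close> as its lower left corner and not as its centre; averages of this form are the ones in the differentiation theorem
\<open>integrable_ccontinuous_explicit\<close>.\<close>

definition square_average :: "(complex \<Rightarrow> complex) \<Rightarrow> real \<Rightarrow> complex \<Rightarrow> complex" where
  "square_average g h z = integral (cbox z (z + h *\<^sub>R One)) g /\<^sub>R h ^ DIM(complex)"

lemma One_complex: "(One :: complex) = Complex 1 1"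
  by (simp add: Basis_complex_def complex_eq_iff)

lemma corr_bump_tendsto:
  assumes g: "locally_integrable g" and h: "0 < h" "h \<le> 1"
  shows "(\<lambda>n. corr (tensor (bump (real (Suc n)) h) (bump (real (Suc n)) h)) g z) \<longlonglongrightarrow> square_average g h z"
proof -
  have [measurable]: "g \<in> borel_measurable borel" using g by (simp add: locally_integrable_def)
  interpret W: smooth_window "bump (real (Suc n)) h" "bump' (real (Suc n)) h" "deriv (bump' (real (Suc n)) h)" h for n
    by (rule smooth_window_bump) (use h in auto)
  let ?S = "box z (z + h *\<^sub>R One)"
  let ?R = "cmod z + 2"
  have box: "indicator ?S t = indicator {0<..<h} (Re (t - z)) * (indicator {0<..<h} (Im (t - z)) :: real)" for t
    unfolding One_complex by (auto simp: in_box_complex_iff indicator_def)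
  have S: "?S \<subseteq> cball 0 ?R"
  proof
    fix t assume "t \<in> ?S"
    then have "\<bar>Re (t - z)\<bar> + \<bar>Im (t - z)\<bar> \<le> 2" using h unfolding One_complex by (auto simp: in_box_complex_iff)
    then have "cmod (t - z) \<le> 2" using cmod_le[of "t - z"] by linarith
    then show "t \<in> cball 0 ?R" using norm_triangle_ineq2[of t z] by simp
  qed
  have gR: "set_integrable lborel (cball 0 ?R) g" using g by (simp add: locally_integrable_def)
  have "(\<lambda>n. corr (tensor (bump (real (Suc n)) h) (bump (real (Suc n)) h)) g z)
      \<longlonglongrightarrow> (\<integral>t. of_real (indicator {0<..<h} (Re (t - z)) / h * (indicator {0<..<h} (Im (t - z)) / h)) * g t \<partial>lborel)"
    unfolding corr_def
  proof (rule integral_dominated_convergence)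
    show "integrable lborel (\<lambda>t. (1 / h\<^sup>2) * norm (indicator (cball 0 ?R) t *\<^sub>R g t))"
      using gR unfolding set_integrable_def by (intro integrable_mult_right integrable_norm)
    show "AE t in lborel. (\<lambda>n. tensor (bump (real (Suc n)) h) (bump (real (Suc n)) h) (t - z) * g t)
       \<longlonglongrightarrow> of_real (indicator {0<..<h} (Re (t - z)) / h * (indicator {0<..<h} (Im (t - z)) / h)) * g t"
      unfolding tensor_def by (intro AE_I2 bump_tendsto h tendsto_mult tendsto_of_real tendsto_const)
    show "AE t in lborel. norm (tensor (bump (real (Suc n)) h) (bump (real (Suc n)) h) (t - z) * g t)
        \<le> (1 / h\<^sup>2) * norm (indicator (cball 0 ?R) t *\<^sub>R g t)" for n
    proof (rule AE_I2)
      fix t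
      let ?b = "bump (real (Suc n)) h"
      have "norm (tensor ?b ?b (t - z)) \<le> (1 / h\<^sup>2) * indicator (cball 0 ?R) t"
      proof (cases "t \<in> cball 0 ?R")
        case True
        have le: "?b x \<le> 1 / h" for x
          by (rule order_trans[OF W.le]) (use h in \<open>simp add: divide_right_mono indicator_def\<close>)
        have "norm (tensor ?b ?b (t - z)) = ?b (Re (t - z)) * ?b (Im (t - z))"
          unfolding tensor_def norm_of_real by (simp only: abs_of_nonneg mult_nonneg_nonneg W.nonneg)
        also have "\<dots> \<le> (1 / h) * (1 / h)" using W.nonneg h by (intro mult_mono le) auto
        finally show ?thesis using True by (simp add: power2_eq_square)
      next
        case False
        then have "2 < cmod (t - z)" using norm_triangle_ineq2[of t z] by simp
        then have "2 < \<bar>Re (t - z)\<bar> + \<bar>Im (t - z)\<bar>" using cmod_le[of "t - z"] by linarith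
        then have "Re (t - z) \<notin> {0..h} \<or> Im (t - z) \<notin> {0..h}" using h by auto
        then have "tensor ?b ?b (t - z) = 0" using W.r_eq_0 by (auto simp: tensor_def)
        then show ?thesis by simp
      qed
      from mult_right_mono[OF this, of "norm (g t)"]
      show "norm (tensor ?b ?b (t - z) * g t) \<le> (1 / h\<^sup>2) * norm (indicator (cball 0 ?R) t *\<^sub>R g t)"
        by (simp add: norm_mult mult.assoc)
    qed
  qed (unfold tensor_def[abs_def], measurable)
  also have "(\<integral>t. of_real (indicator {0<..<h} (Re (t - z)) / h * (indicator {0<..<h} (Im (t - z)) / h)) * g t \<partial>lborel)
      = (\<integral>t. (1 / h\<^sup>2) *\<^sub>R (indicator ?S t *\<^sub>R g t) \<partial>lborel)"
    unfolding box by (intro Bochner_Integration.integral_cong refl) (simp add: scaleR_conv_of_real power2_eq_square)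
  also have "\<dots> = (1 / h\<^sup>2) *\<^sub>R (LINT t:?S|lborel. g t)"
    unfolding set_lebesgue_integral_def by (rule Bochner_Integration.integral_scaleR_right)
  also have "(LINT t:?S|lborel. g t) = integral (cbox z (z + h *\<^sub>R One)) g"
    using set_borel_integral_eq_integral(2)[OF set_integrable_subset[OF gR _ S]]
    by (simp add: integral_open_interval)
  finally show ?thesis
    by (simp add: square_average_def divide_inverse)
qed

context beltrami_solution
begin

text \<open>For every kernel the estimate comes from the increments along the two sides of the path from \<open>z\<close> to \<open>z'\<close>
through the corner with the real part of \<open>z'\<close> and the imaginary part of \<open>z\<close>. The constant is independent of the kernel, so the estimate survives the
limit in which the kernel becomes the indicator of a square.\<close>

lemma square_average_Hoelder:
  "\<exists>K\<ge>0. \<forall>h z z'. 0 < h \<longrightarrow> h \<le> 1 \<longrightarrow> cmod (square_average g h z' - square_average g h z)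
    \<le> K * (sqrt \<bar>Re (z' - z)\<bar> + sqrt \<bar>Im (z' - z)\<bar>)"
proof -
  obtain C where C: "0 \<le> C" "\<And>r r' r'' h. smooth_window r r' r'' h \<Longrightarrow> sqnorm (corr (tensor r' r') g) \<le> ennreal (C\<^sup>2)"
    using mixed_derivative_bound by blast
  \<comment> \<open>a common bound for both first derivatives keeps the two directions symmetric\<close>
  define p where "p = sqrt (\<integral>z. (cmod (P z))\<^sup>2 \<partial>lborel) + sqrt (\<integral>z. (cmod (Q z))\<^sup>2 \<partial>lborel)"
  have p: "0 \<le> p" "sqnorm P \<le> ennreal (p\<^sup>2)" "sqnorm Q \<le> ennreal (p\<^sup>2)"
  proof -
    have le: "x \<le> (sqrt x + sqrt y)\<^sup>2" "y \<le> (sqrt x + sqrt y)\<^sup>2" if "0 \<le> x" "0 \<le> y" for x y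
      using that by (simp_all add: power2_sum)
    show "0 \<le> p" "sqnorm P \<le> ennreal (p\<^sup>2)" "sqnorm Q \<le> ennreal (p\<^sup>2)"
      unfolding sqnorm_eq_integral[OF P] sqnorm_eq_integral[OF Q] p_def by (auto intro!: ennreal_leI le)
  qed
  define K where "K = p + C"
  have K: "0 \<le> K" using p C by (simp add: K_def)
  have window: "cmod (corr (tensor r r) g z' - corr (tensor r r) g z) \<le> K * (sqrt \<bar>Re (z' - z)\<bar> + sqrt \<bar>Im (z' - z)\<bar>)"
    if "smooth_window r r' r'' h" for r r' r'' h z z'
  proof -
    interpret smooth_window r r' r'' h by fact
    let ?u = "corr (tensor r r) g"
    have young: "sqnorm (corr (tensor r r) f) \<le> sqnorm f" if "f \<in> borel_measurable borel" for f
    proof -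
      have "sqnorm (corr (tensor r r) f) \<le> (\<integral>\<^sup>+t. ennreal (cmod (tensor r r t)) \<partial>lborel)\<^sup>2 * sqnorm f"
        using that by (intro sqnorm_corr_le) measurable
      also have "\<dots> \<le> 1\<^sup>2 * sqnorm f"
        by (intro mult_right_mono power_mono nn_integral_tensor) simp_all
      finally show ?thesis by simp
    qed
    have "sqnorm (corr (tensor r' r) g) = sqnorm (corr (tensor r r) P)"
      "sqnorm (corr (tensor r r') g) = sqnorm (corr (tensor r r) Q)"
      using corr_partial[OF tensor_Cc(1)] by (simp_all add: partials sqnorm_def)
    then have b: "sqnorm (corr (tensor r' r) g) \<le> ennreal (p\<^sup>2)" "sqnorm (corr (tensor r r') g) \<le> ennreal (p\<^sup>2)"
      using young[of P] young[of Q] p P Q by (auto simp: square_integrable_def intro: order_trans)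
    have x: "cmod (?u (w + of_real a) - ?u w) \<le> K * sqrt \<bar>a\<bar>" for w a
    proof (cases "0 \<le> a")
      case True
      then show ?thesis using increment_x[OF g True b(1) C(2)[OF that] p(1) C(1), of w] by (simp add: K_def)
    next
      case False
      then show ?thesis using increment_x[OF g _ b(1) C(2)[OF that] p(1) C(1), of "- a" "w + of_real a"]
        by (simp add: K_def norm_minus_commute)
    qed
    have y: "cmod (?u (w + \<i> * of_real a) - ?u w) \<le> K * sqrt \<bar>a\<bar>" for w a
    proof (cases "0 \<le> a")
      case True
      then show ?thesis using increment_y[OF g True b(2) C(2)[OF that] p(1) C(1), of w] by (simp add: K_def)
    next
      case False
      then show ?thesis using increment_y[OF g _ b(2) C(2)[OF that] p(1) C(1), of "- a" "w + \<i> * of_real a"]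
        by (simp add: K_def norm_minus_commute)
    qed
    let ?m = "z + of_real (Re (z' - z))"
    have z': "z' = ?m + \<i> * of_real (Im (z' - z))"
      by (simp add: complex_eq_iff)
    have "cmod (?u z' - ?u z) \<le> cmod (?u z' - ?u ?m) + cmod (?u ?m - ?u z)"
      using norm_triangle_ineq[of "?u z' - ?u ?m" "?u ?m - ?u z"] by simp
    also have "cmod (?u z' - ?u ?m) \<le> K * sqrt \<bar>Im (z' - z)\<bar>"
      using y[of ?m "Im (z' - z)"] z' by simp
    also have "cmod (?u ?m - ?u z) \<le> K * sqrt \<bar>Re (z' - z)\<bar>"
      by (rule x)
    finally show ?thesis by (simp add: algebra_simps)
  qed
  have "cmod (square_average g h z' - square_average g h z) \<le> K * (sqrt \<bar>Re (z' - z)\<bar> + sqrt \<bar>Im (z' - z)\<bar>)"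
    if h: "0 < h" "h \<le> 1" for h z z'
  proof (rule LIMSEQ_le_const2)
    show "(\<lambda>n. cmod (corr (tensor (bump (real (Suc n)) h) (bump (real (Suc n)) h)) g z'
        - corr (tensor (bump (real (Suc n)) h) (bump (real (Suc n)) h)) g z))
      \<longlonglongrightarrow> cmod (square_average g h z' - square_average g h z)"
      by (intro tendsto_norm tendsto_diff corr_bump_tendsto g h)
    show "\<exists>N. \<forall>n\<ge>N. cmod (corr (tensor (bump (real (Suc n)) h) (bump (real (Suc n)) h)) g z'
        - corr (tensor (bump (real (Suc n)) h) (bump (real (Suc n)) h)) g z)
        \<le> K * (sqrt \<bar>Re (z' - z)\<bar> + sqrt \<bar>Im (z' - z)\<bar>)"
      using window[OF smooth_window_bump[OF _ h]] by (metis of_nat_0_less_iff zero_less_Suc)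
  qed
  with K show ?thesis by blast
qed

theorem continuous_representative:
  "\<exists>f. continuous_on UNIV f \<and> (AE z in lebesgue. g z = f z)"
proof -
  obtain K where K: "0 \<le> K" and Hoelder: "\<And>h z z'. 0 < h \<Longrightarrow> h \<le> 1 \<Longrightarrow>
      cmod (square_average g h z' - square_average g h z) \<le> K * (sqrt \<bar>Re (z' - z)\<bar> + sqrt \<bar>Im (z' - z)\<bar>)"
    using square_average_Hoelder by blast
  have "g integrable_on cbox a b" for a b
  proof -
    obtain R where "\<forall>t\<in>cbox a b. norm t \<le> R"
      using bounded_cbox bounded_iff by blast
    then have R: "cbox a b \<subseteq> cball 0 R" by auto
    have "set_integrable lborel (cball 0 R) g" using g by (simp add: locally_integrable_def)
    from set_borel_integral_eq_integral(1)[OF set_integrable_subset[OF this _ R]] show ?thesis by simp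
  qed
  then obtain N where N: "negligible N" and diff: "\<And>z e. z \<notin> N \<Longrightarrow> 0 < e \<Longrightarrow>
      \<exists>d>0. \<forall>h. 0 < h \<and> h < d \<longrightarrow> norm (square_average g h z - g z) < e"
    unfolding square_average_def using integrable_ccontinuous_explicit[of g] by metis
  have lim: "((\<lambda>h. square_average g h z) \<longlongrightarrow> g z) (at_right 0)" if z: "z \<notin> N" for z
  proof (rule tendstoI)
    fix e :: real assume "0 < e"
    then obtain d where "d > 0" "\<forall>h. 0 < h \<and> h < d \<longrightarrow> norm (square_average g h z - g z) < e"
      using diff[OF z] by blast
    then show "eventually (\<lambda>h. dist (square_average g h z) (g z) < e) (at_right 0)"
      unfolding eventually_at_right_field by (auto simp: dist_norm)
  qed
  have bound: "cmod (g z' - g z) \<le> 2 * K * sqrt (dist z' z)" if z: "z \<notin> N" "z' \<notin> N" for z z'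
  proof -
    have "cmod (g z' - g z) \<le> K * (sqrt \<bar>Re (z' - z)\<bar> + sqrt \<bar>Im (z' - z)\<bar>)"
    proof (rule tendsto_upperbound)
      show "((\<lambda>h. cmod (square_average g h z' - square_average g h z)) \<longlongrightarrow> cmod (g z' - g z)) (at_right 0)"
        by (intro tendsto_intros lim z)
      show "eventually (\<lambda>h. cmod (square_average g h z' - square_average g h z)
          \<le> K * (sqrt \<bar>Re (z' - z)\<bar> + sqrt \<bar>Im (z' - z)\<bar>)) (at_right 0)"
        unfolding eventually_at_right_field using Hoelder by (intro exI[of _ 1]) auto
    qed simp
    also have "\<dots> \<le> K * (sqrt (dist z' z) + sqrt (dist z' z))"
      using K by (intro mult_left_mono add_mono real_sqrt_le_mono)
        (simp_all only: dist_norm abs_Re_le_cmod abs_Im_le_cmod)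
    finally show ?thesis by simp
  qed
  have "uniformly_continuous_on (- N) g"
    unfolding uniformly_continuous_on_def
  proof (intro allI impI)
    fix e :: real assume e: "0 < e"
    \<comment> \<open>the summand 1 avoids division by zero when \<open>K\<close> is 0\<close>
    define d where "d = (e / (2 * K + 1))\<^sup>2"
    have d: "0 < d" using e K by (simp add: d_def)
    have "dist (g z') (g z) < e" if "z \<in> - N" "z' \<in> - N" "dist z' z < d" for z z'
    proof -
      have "sqrt (dist z' z) \<le> e / (2 * K + 1)"
        using that(3) e K unfolding d_def by (intro real_le_lsqrt) auto
      then have "2 * K * sqrt (dist z' z) \<le> 2 * K * (e / (2 * K + 1))"
        using K by (intro mult_left_mono) auto
      also have "\<dots> < e" using e K by (simp add: field_simps)
      finally show ?thesis using bound[of z z'] that by (simp add: dist_norm)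
    qed
    with d show "\<exists>d>0. \<forall>x\<in>- N. \<forall>x'\<in>- N. dist x' x < d \<longrightarrow> dist (g x') (g x) < e" by blast
  qed
  then obtain f where f: "uniformly_continuous_on (closure (- N)) f" "\<And>z. z \<in> - N \<Longrightarrow> g z = f z"
    by (rule uniformly_continuous_on_extension_on_closure) blast
  have "interior N = {}"
    using N open_not_negligible[of "interior N"] negligible_subset[OF N interior_subset] by auto
  then have "closure (- N) = UNIV" by (simp add: closure_complement)
  then have "continuous_on UNIV f" using uniformly_continuous_imp_continuous[OF f(1)] by simp
  moreover have "AE z in lebesgue. g z = f z"
    using N f(2) unfolding negligible_iff_null_sets by (intro AE_I'[of N]) auto
  ultimately show ?thesis by blast
qed

end

section \<open>From Lebesgue to Borel measurable functions\<close>

text \<open>The applications of Fubini's theorem above are for the product of the Borel measure with itself, whereas the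
functions in the theorem are only Lebesgue measurable. They are therefore replaced by Borel functions that agree with them almost everywhere, which changes
neither their integrability nor the distributions they define.\<close>

lemma borel_imp_lebesgue_measurable:
  fixes f :: "complex \<Rightarrow> 'b::topological_space"
  shows "f \<in> borel_measurable borel \<Longrightarrow> f \<in> borel_measurable lebesgue"
  by (rule measurable_completion) simp

lemma lebesgue_measurable_borel_version:
  fixes f :: "complex \<Rightarrow> complex"
  assumes f: "f \<in> borel_measurable lebesgue"
  shows "\<exists>f'. f' \<in> borel_measurable borel \<and> (AE z in lebesgue. f z = f' z)"
proof -
  have "(\<lambda>z. Re (f z)) \<in> borel_measurable (completion lborel)" "(\<lambda>z. Im (f z)) \<in> borel_measurable (completion lborel)"
    using f by measurable
  from this[THEN completion_ex_borel_measurable_real]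
  obtain u v where uv: "u \<in> borel_measurable lborel" "v \<in> borel_measurable lborel"
    and ae: "AE z in lborel. Re (f z) = u z" "AE z in lborel. Im (f z) = v z"
    by (elim bexE) rule
  have [measurable]: "u \<in> borel_measurable borel" "v \<in> borel_measurable borel" using uv by simp_all
  have "(\<lambda>z. of_real (u z) + \<i> * of_real (v z)) \<in> borel_measurable borel" by measurable
  moreover have "AE z in lebesgue. f z = of_real (u z) + \<i> * of_real (v z)"
    using AE_completion[OF ae(1)] AE_completion[OF ae(2)]
    by eventually_elim (simp add: complex_eq_iff)
  ultimately show ?thesis by blast
qed

lemma L1_loc_measurable:
  assumes "f \<in> L1_loc" shows "f \<in> borel_measurable lebesgue"
proof (rule borel_measurable_LIMSEQ_metric)
  show "(\<lambda>z. indicator (cball 0 (real n)) z *\<^sub>R f z) \<in> borel_measurable lebesgue" for n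
    by (rule borel_measurable_integrable)
       (use assms in \<open>simp add: L1_loc_def set_integrable_def\<close>)
  show "(\<lambda>n. indicator (cball 0 (real n)) z *\<^sub>R f z) \<longlonglongrightarrow> f z" for z
  proof (rule tendsto_eventually)
    obtain N where "cmod z \<le> real N" using real_arch_simple by blast
    then have "indicator (cball 0 (real n)) z *\<^sub>R f z = f z" if "n \<ge> N" for n
      using that by (simp add: order_trans[of _ "real N"])
    then show "\<forall>\<^sub>F n in sequentially. indicator (cball 0 (real n)) z *\<^sub>R f z = f z"
      by (rule eventually_sequentiallyI)
  qed
qed

lemma L1_loc_version:
  assumes f: "f \<in> L1_loc" and f'[measurable]: "f' \<in> borel_measurable borel" and ae: "AE z in lebesgue. f z = f' z"
  shows "locally_integrable f'"
  unfolding locally_integrable_def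
proof (intro conjI allI f')
  fix R :: real
  have "f \<in> borel_measurable lebesgue" using f by (rule L1_loc_measurable)
  moreover have "f' \<in> borel_measurable lebesgue" using f' by (rule borel_imp_lebesgue_measurable)
  moreover have "(indicator (cball 0 R) :: complex \<Rightarrow> real) \<in> borel_measurable lebesgue"
    by (intro borel_imp_lebesgue_measurable borel_measurable_indicator cball_borel)
  ultimately have m: "(\<lambda>z. indicator (cball 0 R) z *\<^sub>R f z) \<in> borel_measurable lebesgue"
    "(\<lambda>z. indicator (cball 0 R) z *\<^sub>R f' z) \<in> borel_measurable lebesgue"
    by (auto intro: borel_measurable_scaleR)
  have "AE z in lebesgue. indicator (cball 0 R) z *\<^sub>R f z = indicator (cball 0 R) z *\<^sub>R f' z"
    using ae by eventually_elim simp
  from integrable_cong_AE[OF m this]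
  have "integrable lebesgue (\<lambda>z. indicator (cball 0 R) z *\<^sub>R f' z)"
    using f by (simp add: L1_loc_def set_integrable_def)
  moreover have "(\<lambda>z. indicator (cball 0 R) z *\<^sub>R f' z) \<in> borel_measurable lborel" by simp
  ultimately show "set_integrable lborel (cball 0 R) f'"
    unfolding set_integrable_def using integrable_completion by blast
qed

lemma L2_version:
  assumes f: "f \<in> L2" and f'[measurable]: "f' \<in> borel_measurable borel" and ae: "AE z in lebesgue. f z = f' z"
  shows "square_integrable f'"
  unfolding square_integrable_iff
proof
  have "f \<in> borel_measurable lebesgue" "integrable lebesgue (\<lambda>z. (cmod (f z))\<^sup>2)"
    using f by (auto simp: L2_def)
  moreover have "f' \<in> borel_measurable lebesgue" using f' by (rule borel_imp_lebesgue_measurable)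
  ultimately have m: "(\<lambda>z. (cmod (f z))\<^sup>2) \<in> borel_measurable lebesgue"
    "(\<lambda>z. (cmod (f' z))\<^sup>2) \<in> borel_measurable lebesgue" by simp_all
  have "AE z in lebesgue. (cmod (f z))\<^sup>2 = (cmod (f' z))\<^sup>2"
    using ae by eventually_elim simp
  from integrable_cong_AE[OF m this]
  have "integrable lebesgue (\<lambda>z. (cmod (f' z))\<^sup>2)" using f by (simp add: L2_def)
  moreover have "(\<lambda>z. (cmod (f' z))\<^sup>2) \<in> borel_measurable lborel" by simp
  ultimately show "integrable lborel (\<lambda>z. (cmod (f' z))\<^sup>2)"
    using integrable_completion by blast
qed (rule f')

lemma distr_of_version:
  assumes f: "f \<in> borel_measurable lebesgue" and f'[measurable]: "f' \<in> borel_measurable borel"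
    and ae: "AE z in lebesgue. f z = f' z" and \<phi>: "\<phi> \<in> Cc_infinity"
  shows "distr_of f \<phi> = (\<integral>z. \<phi> z * f' z \<partial>lborel)"
proof -
  have [measurable]: "\<phi> \<in> borel_measurable borel"
    using \<phi> by (intro cc_kernelD(1) Cc_infinity_cc_kernel)
  have m: "\<phi> \<in> borel_measurable lebesgue" "f' \<in> borel_measurable lebesgue"
    by (simp_all add: borel_imp_lebesgue_measurable)
  have "AE z in lebesgue. f z * \<phi> z = \<phi> z * f' z"
    using ae by eventually_elim simp
  then have "distr_of f \<phi> = (\<integral>z. \<phi> z * f' z \<partial>lebesgue)"
    unfolding distr_of_def by (rule integral_cong_AE[rotated 2]) (intro borel_measurable_times f m)+
  also have "\<dots> = (\<integral>z. \<phi> z * f' z \<partial>lborel)"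
    by (rule integral_completion) measurable
  finally show ?thesis .
qed

section \<open>Continuity of solutions\<close>

theorem theorem4p5:
  fixes \<mu> F g g\<^sub>x g\<^sub>y :: "complex \<Rightarrow> complex" and k :: real
  assumes "\<mu> \<in> Cc_infinity" and "F \<in> Cc_infinity"
    and "\<And>z. cmod (\<mu> z) \<le> k" and "k < 1"
    and "g \<in> L1_loc"
    and "has_weak_partial g 1 g\<^sub>x" and "has_weak_partial g \<i> g\<^sub>y"
    and "g\<^sub>x \<in> L2" and "g\<^sub>y \<in> L2"
    and "distr_eq
           (\<lambda>\<phi>. distr_dzbar (distr_of g) \<phi> - distr_mult \<mu> (distr_dz (distr_of g)) \<phi>)
           (distr_of F)"
  shows "\<exists>h. continuous_on UNIV h \<and> (AE z in lebesgue. g z = h z)"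
proof -
  have meas: "g \<in> borel_measurable lebesgue" "g\<^sub>x \<in> borel_measurable lebesgue" "g\<^sub>y \<in> borel_measurable lebesgue"
    using assms(5,6,7) by (auto simp: has_weak_partial_def L1_loc_measurable)
  obtain g' P Q where
      g': "g' \<in> borel_measurable borel" "AE z in lebesgue. g z = g' z"
    and P: "P \<in> borel_measurable borel" "AE z in lebesgue. g\<^sub>x z = P z"
    and Q: "Q \<in> borel_measurable borel" "AE z in lebesgue. g\<^sub>y z = Q z"
    using meas[THEN lebesgue_measurable_borel_version] by blast
  note dg = distr_of_version[OF meas(1) g']
  note dP = distr_of_version[OF meas(2) P]
  note dQ = distr_of_version[OF meas(3) Q]
  have "F \<in> borel_measurable borel"
    using assms(2) by (intro cc_kernelD(1) Cc_infinity_cc_kernel)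
  then have dF: "distr_of F \<phi> = (\<integral>t. \<phi> t * F t \<partial>lborel)" if "\<phi> \<in> Cc_infinity" for \<phi>
    using that by (intro distr_of_version borel_imp_lebesgue_measurable) auto
  have sP: "square_integrable P" and sQ: "square_integrable Q"
    using L2_version[OF assms(8) P] L2_version[OF assms(9) Q] by auto
  have wx: "distr_partial 1 (distr_of g) \<phi> = (\<integral>t. \<phi> t * P t \<partial>lborel)"
    and wy: "distr_partial \<i> (distr_of g) \<phi> = (\<integral>t. \<phi> t * Q t \<partial>lborel)"
    if "\<phi> \<in> Cc_infinity" for \<phi>
    using assms(6,7) that dP dQ by (auto simp: has_weak_partial_def distr_eq_def)
  interpret beltrami_solution \<mu> F g' P Q k
  proof
    show "\<mu> \<in> Cc_infinity" "F \<in> Cc_infinity" "cmod (\<mu> z) \<le> k" "k < 1" for z by fact+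
    show "locally_integrable g'" by (rule L1_loc_version[OF assms(5) g'])
    show "square_integrable P" "square_integrable Q" by fact+
    fix \<phi> assume \<phi>: "\<phi> \<in> Cc_infinity"
    show "(\<integral>t. partial 1 \<phi> t * g' t \<partial>lborel) = - (\<integral>t. \<phi> t * P t \<partial>lborel)"
      using wx[OF \<phi>] dg[OF Cc_infinity_partial(1)[OF \<phi>]] by (simp add: distr_partial_def minus_equation_iff)
    show "(\<integral>t. partial \<i> \<phi> t * g' t \<partial>lborel) = - (\<integral>t. \<phi> t * Q t \<partial>lborel)"
      using wy[OF \<phi>] dg[OF Cc_infinity_partial(2)[OF \<phi>]] by (simp add: distr_partial_def minus_equation_iff)
    have int: "integrable lborel (\<lambda>t. \<psi> t * P t)" "integrable lborel (\<lambda>t. \<psi> t * Q t)" if "\<psi> \<in> Cc_infinity" for \<psi>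
      using that sP sQ
      by (auto intro!: integrable_cc_mult Cc_infinity_cc_kernel square_integrable_imp_locally_integrable)
    \<comment> \<open>\<open>\<mu>\<close> acts on a distribution through the test function\<close>
    have \<mu>\<phi>: "(\<lambda>t. \<mu> t * \<phi> t) \<in> Cc_infinity"
      by (rule Cc_infinity_mult[OF Cc_infinityD(1)[OF assms(1)] \<phi>])
    have "(\<integral>t. \<phi> t * ((P t + \<i> * Q t) / 2) \<partial>lborel) = distr_dzbar (distr_of g) \<phi>"
    proof -
      have "(\<lambda>t. \<phi> t * ((P t + \<i> * Q t) / 2)) = (\<lambda>t. (\<phi> t * P t + \<i> * (\<phi> t * Q t)) / 2)"
        by (simp add: fun_eq_iff field_simps)
      then show ?thesis using int[OF \<phi>] by (simp add: distr_dzbar_def wx[OF \<phi>] wy[OF \<phi>])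
    qed
    moreover have "(\<integral>t. \<phi> t * (\<mu> t * ((P t - \<i> * Q t) / 2)) \<partial>lborel) = distr_mult \<mu> (distr_dz (distr_of g)) \<phi>"
    proof -
      have "(\<lambda>t. \<phi> t * (\<mu> t * ((P t - \<i> * Q t) / 2)))
          = (\<lambda>t. (\<mu> t * \<phi> t * P t - \<i> * (\<mu> t * \<phi> t * Q t)) / 2)"
        by (simp add: fun_eq_iff field_simps)
      then show ?thesis using int[OF \<mu>\<phi>] by (simp add: distr_mult_def distr_dz_def wx[OF \<mu>\<phi>] wy[OF \<mu>\<phi>])
    qed
    moreover have "distr_dzbar (distr_of g) \<phi> - distr_mult \<mu> (distr_dz (distr_of g)) \<phi> = (\<integral>t. \<phi> t * F t \<partial>lborel)"
      using assms(10) \<phi> dF[OF \<phi>] by (simp add: distr_eq_def)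
    ultimately show "(\<integral>t. \<phi> t * ((P t + \<i> * Q t) / 2) \<partial>lborel)
        = (\<integral>t. \<phi> t * (\<mu> t * ((P t - \<i> * Q t) / 2)) \<partial>lborel) + (\<integral>t. \<phi> t * F t \<partial>lborel)"
      by (simp add: algebra_simps)
  qed
  obtain h where "continuous_on UNIV h" "AE z in lebesgue. g' z = h z"
    using continuous_representative by blast
  moreover from this(2) g'(2) have "AE z in lebesgue. g z = h z"
    by eventually_elim simp
  ultimately show ?thesis by blast
qed

end
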